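(* Let $d, D$ be positive integers. (a) Let $d\ge 2$, $p\in(0,1)$ and $\eta\in\Omega_d$. For $\mathbb{P}_p$-a.e. $\omega\in\Omega_D$, there exists no $1$-Lip embedding of $\eta$ into $\omega$. (b) Let $d<D$. For every $p\in(0,1)$, there exists an integer $M\ge 1$ such that for $\mathbb{P}_p$-a.e. $\omega\in\Omega_D$, it is the case that for every $\eta\in\Omega_d$ there exists an $M$-Lip embedding of $\eta$ into $\omega$. (c) Let $d=D$ and let $\eta\in\Omega_d$ be a partially periodic configuration. For every $p\in(0,1)$, every integer $M\ge 1$, and for $\mathbb{P}_p$-a.e. $\omega\in\Omega_D$, there exists no $M$-Lip embedding of $\eta$ into $\omega$.
   Context: $\|\cdot\|=\|\cdot\|_1$ denotes the $\ell^1$-norm. For a positive integer $M$, a map $f:\mathbb{Z}^d\to\mathbb{Z}^D$ is $M$-Lipschitz ($M$-Lip) if $\|f(x)-f(y)\|\le M$ for all $x,y\in\mathbb{Z}^d$ with $\|x-y\|=1$. $\Omega_d:=\{0,1\}^{\mathbb{Z}^d}$ is the space of percolation configurations, in which the value $1$ (resp. $0$) is identified with the state "open" (resp. "closed"). $\mathbb{P}_p$ denotes the product measure on $\Omega_D$ under which each site of $\mathbb{Z}^D$ independently has value $1$ with probability $p$ and value $0$ with probability $1-p$. An embedding of a configuration $\eta\in\Omega_d$ into a configuration $\omega\in\Omega_D$ is an injection $f:\mathbb{Z}^d\to\mathbb{Z}^D$ such that $\eta(x)=\omega(f(x))$ for all $x\in\mathbb{Z}^d$; an $M$-Lip embedding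 is an embedding that is $M$-Lip. A configuration $\eta\in\Omega_d$ is partially periodic if there exist $x\in\mathbb{Z}^d$ and a positive integer $r$ such that $\eta(x)=\eta(x+ry)$ for all $y\in\mathbb{Z}^d$. *)

theory Defs
  imports "HOL-Probability.Probability"
begin

text \<open>
  The lattice \<open>\<int>\<^sup>d\<close> is the type \<open>int ^ 'd\<close> with \<open>d = CARD('d)\<close>; since types are
  nonempty, \<open>d \<ge> 1\<close> holds automatically.
\<close>

definition l1_norm :: "int ^ 'd::finite \<Rightarrow> int" where
  "l1_norm x = (\<Sum>i\<in>UNIV. \<bar>x $ i\<bar>)"

definition Lip :: "int \<Rightarrow> (int ^ 'd::finite \<Rightarrow> int ^ 'D::finite) \<Rightarrow> bool" where
  "Lip M f \<longleftrightarrow> (\<forall>x y. l1_norm (x - y) = 1 \<longrightarrow> l1_norm (f x - f y) \<le> M)"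

text \<open>The value 1 (open) is \<open>True\<close>, the value 0 (closed) is \<open>False\<close>.\<close>

type_synonym 'd config = "int ^ 'd \<Rightarrow> bool"

definition percolation :: "real \<Rightarrow> 'D::finite config measure" where
  "percolation p = PiM UNIV (\<lambda>_. measure_pmf (bernoulli_pmf p))"

definition embedding ::
    "'d::finite config \<Rightarrow> 'D::finite config \<Rightarrow> (int ^ 'd \<Rightarrow> int ^ 'D) \<Rightarrow> bool" where
  "embedding \<eta> \<omega> f \<longleftrightarrow> inj f \<and> (\<forall>x. \<eta> x = \<omega> (f x))"

definition Lip_embedding ::
    "int \<Rightarrow> 'd::finite config \<Rightarrow> 'D::finite config \<Rightarrow> (int ^ 'd \<Rightarrow> int ^ 'D) \<Rightarrow> bool" where
  "Lip_embedding M \<eta> \<omega> f \<longleftrightarrow> embedding \<eta> \<omega> f \<and> Lip M f"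

definition partially_periodic :: "'d::finite config \<Rightarrow> bool" where
  "partially_periodic \<eta> \<longleftrightarrow> (\<exists>x. \<exists>r>0. \<forall>y. \<eta> x = \<eta> (x + r *s y))"

end

theory Submission
  imports Defs "HOL-Library.Transitive_Closure_Table"
begin

text \<open>
  In each part geometry reduces the existence of an embedding or of an obstruction to few enough
  possibilities for a union bound.

  For 1-Lipschitz embeddings in dimension at least two, rigidity leaves few candidates. An injective
  1-Lipschitz map takes lattice squares to lattice squares, so on a coordinate plane it is the sum of
  a function of one coordinate and a function of the other (\<open>quadrant_image_splits\<close>). Hence an
  \<open>n \<times> n\<close> square has only exponentially many images in \<open>n\<close>, while a prescribed pattern
  on \<open>n\<^sup>2\<close> sites has a probability exponentially small in \<open>n\<^sup>2\<close>.

  In a lattice of higher dimension one looks for the graph of a Lipschitz function over \<open>\<int>\<^sup>d\<close>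
  consisting of blocks that contain both an open and a closed site; such blocks accommodate every
  configuration. Long blocks have this property with a probability close to one, and then the
  graph exists by a Peierls argument (\<open>Lipschitz_surface_if_bounded_reach\<close>,
  \<open>AE_bounded_reach\<close>).

  In equal dimensions \<open>D\<close>, a partially periodic configuration contains a constant one on a
  sublattice, so it is enough to exclude injective Lipschitz maps into the sites of one state. The
  obstruction is that \<open>\<int>\<^sup>D\<close> cannot be coloured with \<open>D\<close> colours such that monochromatic
  components are bounded; this is the Hex lemma (\<open>hex\<close>), a consequence of Brouwer's fixed point
  theorem. On the other hand, the map avoids large cubes of the opposite state, and these are so
  frequent that on a large scale, with high probability, every cell near the image of the origin
  contains one. The complement of such holes retracts to the walls of the cells, a set of dimension
  \<open>D - 1\<close>, which can be coloured with \<open>D\<close> colours and bounded components. The pullback of this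
  colouring along the injection contradicts the Hex lemma (\<open>no_injection_avoiding_holes\<close>). Since the colouring is only
  needed on a region whose size is polynomial in the scale, whereas a cell lacks a hole with a
  probability exponentially small in the scale, the map almost surely does not exist.
\<close>

section \<open>Events determined by finitely many sites\<close>

lemma prob_space_percolation: "prob_space (percolation p)"
  unfolding percolation_def by (intro prob_space_PiM) (rule prob_space_measure_pmf)

lemma space_percolation [simp]: "space (percolation p) = UNIV"
  by (simp add: percolation_def space_PiM PiE_UNIV_domain)

lemma cylinder_percolation:
  fixes S :: "(int ^ 'D::finite) set"
  assumes p: "0 < p" "p < 1" and S: "finite S"
  shows "{\<omega>. \<forall>s\<in>S. \<omega> s = g s} \<in> sets (percolation p)"
    and "measure (percolation p) {\<omega>. \<forall>s\<in>S. \<omega> s = g s} = (\<Prod>s\<in>S. if g s then p else 1 - p)"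
proof -
  interpret product_prob_space "\<lambda>_. measure_pmf (bernoulli_pmf p)" "UNIV :: (int ^ 'D) set"
    by unfold_locales
  have eq: "prod_emb UNIV (\<lambda>_. measure_pmf (bernoulli_pmf p)) S (Pi\<^sub>E S (\<lambda>s. {g s}))
      = {\<omega>. \<forall>s\<in>S. \<omega> s = g s}"
  proof -
    have "(restrict \<omega> S \<in> Pi\<^sub>E S (\<lambda>s. {g s})) \<longleftrightarrow> (\<forall>s\<in>S. \<omega> s = g s)" for \<omega>
      unfolding PiE_iff by simp
    then show ?thesis
      unfolding prod_emb_def vimage_def
      by (simp only: space_measure_pmf PiE_UNIV_domain UNIV_I simp_thms) simp
  qed
  have "prod_emb UNIV (\<lambda>_. measure_pmf (bernoulli_pmf p)) S (Pi\<^sub>E S (\<lambda>s. {g s}))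
      \<in> sets (percolation p)"
    unfolding percolation_def using S by (intro sets_PiM_I) auto
  then show "{\<omega>. \<forall>s\<in>S. \<omega> s = g s} \<in> sets (percolation p)"
    by (simp add: eq)
  have "measure (percolation p) {\<omega>. \<forall>s\<in>S. \<omega> s = g s}
      = (\<Prod>s\<in>S. measure (measure_pmf (bernoulli_pmf p)) {g s})"
    unfolding percolation_def eq[symmetric] using S by (subst measure_PiM_emb) auto
  also have "\<dots> = (\<Prod>s\<in>S. if g s then p else 1 - p)"
    using p by (intro prod.cong) (auto simp: measure_pmf_single)
  finally show "measure (percolation p) {\<omega>. \<forall>s\<in>S. \<omega> s = g s}
      = (\<Prod>s\<in>S. if g s then p else 1 - p)" .
qed

text \<open>
  The sites are given by an injective placement \<open>pos\<close> of an index set, because the states that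
  an embedding prescribes come indexed by points of its domain.
\<close>

lemma prob_pattern_le:
  fixes pos :: "'t \<Rightarrow> int ^ 'D::finite"
  assumes p: "0 < p" "p < 1" and T: "finite T" and inj: "inj_on pos T"
  shows "{\<omega>. \<forall>t\<in>T. \<omega> (pos t) = h t} \<in> sets (percolation p)"
    and "measure (percolation p) {\<omega>. \<forall>t\<in>T. \<omega> (pos t) = h t} \<le> max p (1 - p) ^ card T"
proof -
  let ?g = "\<lambda>s. h (inv_into T pos s)"
  have eq: "{\<omega>. \<forall>t\<in>T. \<omega> (pos t) = h t} = {\<omega>. \<forall>s\<in>pos ` T. \<omega> s = ?g s}"
    using inj by simp
  show "{\<omega>. \<forall>t\<in>T. \<omega> (pos t) = h t} \<in> sets (percolation p)"
    unfolding eq using p T by (intro cylinder_percolation) auto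
  have "(\<Prod>s\<in>pos ` T. if ?g s then p else 1 - p) \<le> (\<Prod>s\<in>pos ` T. max p (1 - p))"
    using p by (intro prod_mono) auto
  also have "\<dots> = max p (1 - p) ^ card T"
    using inj by (simp add: card_image)
  finally show "measure (percolation p) {\<omega>. \<forall>t\<in>T. \<omega> (pos t) = h t} \<le> max p (1 - p) ^ card T"
    unfolding eq using p T by (subst cylinder_percolation) auto
qed

lemma prob_UN_le:
  assumes "finite W" "\<And>w. w \<in> W \<Longrightarrow> E w \<in> sets (percolation p)"
    and "\<And>w. w \<in> W \<Longrightarrow> measure (percolation p) (E w) \<le> c"
  shows "measure (percolation p) (\<Union>w\<in>W. E w) \<le> real (card W) * c"
proof -
  interpret M: prob_space "percolation p" by (rule prob_space_percolation)
  have "measure (percolation p) (\<Union>w\<in>W. E w) \<le> (\<Sum>w\<in>W. measure (percolation p) (E w))"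
    using assms by (intro M.finite_measure_subadditive_finite) auto
  also have "\<dots> \<le> real (card W) * c"
    using assms by (intro sum_bounded_above) auto
  finally show ?thesis .
qed

definition determined_by :: "(int ^ 'D) set \<Rightarrow> ('D::finite config \<Rightarrow> bool) \<Rightarrow> bool" where
  "determined_by S P \<longleftrightarrow> (\<forall>\<omega> \<omega>'. (\<forall>s\<in>S. \<omega> s = \<omega>' s) \<longrightarrow> P \<omega> = P \<omega>')"

text \<open>
  Only finitely many patterns occur on \<open>S\<close>, and each of them defines a cylinder.
\<close>

lemma sets_determined_by:
  fixes S :: "(int ^ 'D::finite) set"
  assumes p: "0 < p" "p < 1" and S: "finite S" and P: "determined_by S P"
  shows "{\<omega>. P \<omega>} \<in> sets (percolation p)"
proof -
  have "{\<omega>. P \<omega>} = (\<Union>A\<in>{A. A \<subseteq> S \<and> P (\<lambda>s. s \<in> A)}. {\<omega>. \<forall>s\<in>S. \<omega> s = (s \<in> A)})"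
  proof (intro set_eqI iffI)
    fix \<omega> assume "\<omega> \<in> {\<omega>. P \<omega>}"
    moreover have "P \<omega> = P (\<lambda>s. s \<in> {s\<in>S. \<omega> s})"
      using P unfolding determined_by_def by simp
    ultimately show "\<omega> \<in> (\<Union>A\<in>{A. A \<subseteq> S \<and> P (\<lambda>s. s \<in> A)}. {\<omega>. \<forall>s\<in>S. \<omega> s = (s \<in> A)})"
      by (intro UN_I[of "{s\<in>S. \<omega> s}"]) auto
  next
    fix \<omega> assume "\<omega> \<in> (\<Union>A\<in>{A. A \<subseteq> S \<and> P (\<lambda>s. s \<in> A)}. {\<omega>. \<forall>s\<in>S. \<omega> s = (s \<in> A)})"
    then obtain A where "P (\<lambda>s. s \<in> A)" "\<forall>s\<in>S. \<omega> s = (s \<in> A)" by auto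
    then show "\<omega> \<in> {\<omega>. P \<omega>}" using P unfolding determined_by_def by (metis mem_Collect_eq)
  qed
  also have "\<dots> \<in> sets (percolation p)"
    using S by (intro sets.finite_UN cylinder_percolation p) auto
  finally show ?thesis .
qed

text \<open>
  Restrictions of an independent family to disjoint blocks of indices are independent, and an
  event determined by a finite block is a preimage under the restriction to that block.
\<close>

lemma prob_disjoint_blocks:
  fixes B :: "'t \<Rightarrow> (int ^ 'D::finite) set"
  assumes p: "0 < p" "p < 1" and I: "finite I" and fin: "\<And>t. t \<in> I \<Longrightarrow> finite (B t)"
    and dis: "disjoint_family_on B I" and det: "\<And>t. t \<in> I \<Longrightarrow> determined_by (B t) (P t)"
  shows "measure (percolation p) {\<omega>. \<forall>t\<in>I. P t \<omega>} = (\<Prod>t\<in>I. measure (percolation p) {\<omega>. P t \<omega>})"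
proof (cases "I = {}")
  case True
  then show ?thesis using prob_space.prob_space[OF prob_space_percolation, of p] by simp
next
  case False
  let ?m = "\<lambda>_::int ^ 'D. measure_pmf (bernoulli_pmf p)"
  interpret product_prob_space ?m "UNIV :: (int ^ 'D) set"
    by unfold_locales
  let ?M = "percolation p :: 'D config measure"
  interpret M: prob_space ?M by (rule prob_space_percolation)
  have "M.indep_vars ?m (\<lambda>s \<omega>. \<omega> s) UNIV"
  proof (subst M.indep_vars_iff_distr_eq_PiM)
    show "distr ?M (Pi\<^sub>M UNIV ?m) (\<lambda>x. \<lambda>i\<in>UNIV. x i) = (\<Pi>\<^sub>M i\<in>UNIV. distr ?M (?m i) (\<lambda>\<omega>. \<omega> i))"
      unfolding percolation_def by (simp add: PiM_component restrict_UNIV cong: PiM_cong)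
  qed (auto simp: percolation_def)
  then have ind: "M.indep_vars (\<lambda>t. PiM (B t) ?m) (\<lambda>t \<omega>. restrict (\<lambda>s. \<omega> s) (B t)) I"
    by (rule M.indep_vars_restrict) (use dis in auto)
  have sets_B: "sets (PiM (B t) ?m) = Pow (B t \<rightarrow>\<^sub>E UNIV)" if "t \<in> I" for t
  proof -
    have "sets (PiM (B t) ?m) = sets (PiM (B t) (\<lambda>_. count_space (UNIV :: bool set)))"
      by (intro sets_PiM_cong) auto
    also have "\<dots> = sets (count_space (B t \<rightarrow>\<^sub>E UNIV))"
      using fin[OF that] by (subst count_space_PiM_finite) auto
    finally show ?thesis by simp
  qed
  have eq: "{\<omega>. P t \<omega>} = (\<lambda>\<omega>. restrict (\<lambda>s. \<omega> s) (B t)) -` {x \<in> B t \<rightarrow>\<^sub>E UNIV. P t x} \<inter> space ?M"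
    if "t \<in> I" for t
  proof -
    have "P t \<omega> = P t (restrict \<omega> (B t))" for \<omega>
      using det[OF that] unfolding determined_by_def by simp
    then show ?thesis by auto
  qed
  have "measure ?M (\<Inter>t\<in>I. {\<omega>. P t \<omega>}) = (\<Prod>t\<in>I. measure ?M {\<omega>. P t \<omega>})"
  proof (rule M.indep_setsD[OF _ subset_refl False I])
    show "M.indep_sets (\<lambda>t. {(\<lambda>\<omega>. restrict (\<lambda>s. \<omega> s) (B t)) -` A \<inter> space ?M | A. A \<in> sets (PiM (B t) ?m)}) I"
      using ind unfolding M.indep_vars_def2 by auto
    show "\<forall>t\<in>I. {\<omega>. P t \<omega>} \<in> {(\<lambda>\<omega>. restrict (\<lambda>s. \<omega> s) (B t)) -` A \<inter> space ?M | A. A \<in> sets (PiM (B t) ?m)}"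
    proof
      fix t assume t: "t \<in> I"
      have "{x \<in> B t \<rightarrow>\<^sub>E UNIV. P t x} \<in> sets (PiM (B t) ?m)"
        unfolding sets_B[OF t] by blast
      with eq[OF t] show "{\<omega>. P t \<omega>} \<in> {(\<lambda>\<omega>. restrict (\<lambda>s. \<omega> s) (B t)) -` A \<inter> space ?M | A. A \<in> sets (PiM (B t) ?m)}"
        by blast
    qed
  qed
  also have "(\<Inter>t\<in>I. {\<omega>. P t \<omega>}) = {\<omega>. \<forall>t\<in>I. P t \<omega>}" by auto
  finally show ?thesis .
qed

text \<open>
  The events of interest are existence statements about embeddings and paths. They are dealt with
  through measurable covers of arbitrarily small probability, whose intersection is a null set.
\<close>

lemma AE_not_if_small_covers:
  assumes "\<And>e::real. 0 < e \<Longrightarrow>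
    \<exists>N \<in> sets (percolation p). {\<omega>. Q \<omega>} \<subseteq> N \<and> measure (percolation p) N \<le> e"
  shows "AE \<omega> in percolation p. \<not> Q \<omega>"
proof -
  interpret M: prob_space "percolation p" by (rule prob_space_percolation)
  have "\<exists>N \<in> sets (percolation p). {\<omega>. Q \<omega>} \<subseteq> N \<and> measure (percolation p) N \<le> inverse (real (Suc n))" for n
    by (rule assms) simp
  then obtain N where N: "\<And>n. N n \<in> sets (percolation p)" "\<And>n. {\<omega>. Q \<omega>} \<subseteq> N n"
    "\<And>n. measure (percolation p) (N n) \<le> inverse (real (Suc n))"
    by metis
  have "measure (percolation p) (\<Inter>n. N n) \<le> inverse (real (Suc n))" for n
    by (rule order_trans[OF M.finite_measure_mono N(3)]) (use N in auto)
  then have "measure (percolation p) (\<Inter>n. N n) \<le> 0"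
    using LIMSEQ_le_const[OF LIMSEQ_inverse_real_of_nat] by blast
  then have "measure (percolation p) (\<Inter>n. N n) = 0"
    by (simp add: measure_le_0_iff)
  then have "(\<Inter>n. N n) \<in> null_sets (percolation p)"
    using N(1) by (auto simp: null_sets_def M.emeasure_eq_measure)
  then show ?thesis by (rule AE_I') (use N(2) in auto)
qed

section \<open>Arithmetic of the lattice norm\<close>

lemma l1_norm_nonneg: "0 \<le> l1_norm u"
  by (simp add: l1_norm_def sum_nonneg)

lemma l1_norm_0 [simp]: "l1_norm 0 = 0"
  by (simp add: l1_norm_def)

lemma l1_norm_eq_0_iff: "l1_norm u = 0 \<longleftrightarrow> u = 0"
  by (auto simp: l1_norm_def sum_nonneg_eq_0_iff vec_eq_iff)

lemma l1_norm_triangle: "l1_norm (u + v) \<le> l1_norm u + l1_norm v"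
  unfolding l1_norm_def sum.distrib[symmetric] by (intro sum_mono) auto

lemma l1_norm_minus_commute: "l1_norm (u - v) = l1_norm (v - u)"
  unfolding l1_norm_def by (simp add: abs_minus_commute)

lemma l1_norm_axis: "l1_norm (axis k s) = \<bar>s\<bar>"
proof -
  have "l1_norm (axis k s) = (\<Sum>i\<in>UNIV. if i = k then \<bar>s\<bar> else 0)"
    unfolding l1_norm_def by (intro sum.cong) (auto simp: axis_def)
  then show ?thesis by simp
qed

lemma component_le_l1_norm: "\<bar>u $ i\<bar> \<le> l1_norm u"
  unfolding l1_norm_def by (rule member_le_sum) auto

lemma l1_norm_eq_1_iff: "l1_norm u = 1 \<longleftrightarrow> (\<exists>k s. \<bar>s\<bar> = 1 \<and> u = axis k s)"
proof
  assume 1: "l1_norm u = 1"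
  then obtain k where k: "u $ k \<noteq> 0"
    by (metis l1_norm_0 vec_eq_iff zero_index zero_neq_one)
  have sum: "l1_norm u = \<bar>u $ k\<bar> + (\<Sum>i\<in>UNIV - {k}. \<bar>u $ i\<bar>)"
    unfolding l1_norm_def by (rule sum.remove) auto
  have "0 \<le> (\<Sum>i\<in>UNIV - {k}. \<bar>u $ i\<bar>)" by (simp add: sum_nonneg)
  with 1 k sum have "\<bar>u $ k\<bar> = 1" and "(\<Sum>i\<in>UNIV - {k}. \<bar>u $ i\<bar>) = 0" by linarith+
  then have "u = axis k (u $ k)"
    by (auto simp: vec_eq_iff axis_def sum_nonneg_eq_0_iff)
  with \<open>\<bar>u $ k\<bar> = 1\<close> show "\<exists>k s. \<bar>s\<bar> = 1 \<and> u = axis k s" by blast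
qed (auto simp: l1_norm_axis)

lemma finite_units: "finite {u :: int ^ 'n::finite. l1_norm u = 1}"
proof -
  have "{u :: int ^ 'n. l1_norm u = 1} \<subseteq> (\<lambda>(k, s). axis k s) ` (UNIV \<times> {1, -1})"
    by (auto simp: l1_norm_eq_1_iff image_iff abs_if split: if_splits)
  then show ?thesis by (rule finite_subset) auto
qed

section \<open>One-Lipschitz injections of the quadrant\<close>

text \<open>
  The sum of two unit vectors determines them up to order unless it vanishes. The last two
  assumptions are what injectivity gives on a lattice square with edges \<open>u\<close>, \<open>v'\<close> along
  one route and \<open>v\<close>, \<open>u'\<close> along the other: they exclude routes that share their first
  edge and routes that backtrack.
\<close>

lemma opposite_edges_equal:
  assumes "l1_norm u = 1" "l1_norm v = 1" "l1_norm u' = 1" "l1_norm v' = 1"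
    and eq: "u + v' = v + u'" and "u \<noteq> v" "u + v' \<noteq> 0"
  shows "u' = u"
proof -
  obtain a s where u: "\<bar>s\<bar> = 1" "u = axis a s" using assms(1) l1_norm_eq_1_iff by blast
  obtain b t where v: "\<bar>t\<bar> = 1" "v = axis b t" using assms(2) l1_norm_eq_1_iff by blast
  obtain c q where u': "\<bar>q\<bar> = 1" "u' = axis c q" using assms(3) l1_norm_eq_1_iff by blast
  obtain d r where v': "\<bar>r\<bar> = 1" "v' = axis d r" using assms(4) l1_norm_eq_1_iff by blast
  \<comment> \<open>In the coordinate of \<open>u\<close>, parity and size of the two sides leave only \<open>u' = u\<close>.\<close>
  have comp: "s + (if a = d then r else 0) = (if a = b then t else 0) + (if a = c then q else 0)"
    using arg_cong[OF eq, of "\<lambda>w. w $ a"] u v u' v' by (simp add: axis_def)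
  have "a \<noteq> b \<or> s \<noteq> t" using \<open>u \<noteq> v\<close> u v by auto
  moreover have "a \<noteq> d \<or> s \<noteq> - r"
    using \<open>u + v' \<noteq> 0\<close> unfolding u v' by (auto simp: vec_eq_iff axis_def split: if_splits)
  ultimately have "c = a \<and> q = s"
    using comp u(1) v(1) u'(1) v'(1)
    by (cases "a = b"; cases "a = c"; cases "a = d"; simp; linarith)
  then show ?thesis using u u' by simp
qed

text \<open>
  Each lattice square has to go to a lattice square, so opposite edges have equal images, and
  the image of a quadrant is a sum of two paths.
\<close>

lemma quadrant_image_splits:
  fixes G :: "nat \<Rightarrow> nat \<Rightarrow> int ^ 'D::finite"
  assumes inj: "\<And>i j i' j'. G i j = G i' j' \<Longrightarrow> i = i' \<and> j = j'"
    and hor: "\<And>i j. l1_norm (G (Suc i) j - G i j) = 1"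
    and ver: "\<And>i j. l1_norm (G i (Suc j) - G i j) = 1"
  shows "G i j = G i 0 + G 0 j - G 0 0"
proof -
  have step: "G (Suc i) (Suc j) - G i (Suc j) = G (Suc i) j - G i j" for i j
  proof (rule opposite_edges_equal[OF hor ver hor ver])
    show "G (Suc i) j - G i j + (G (Suc i) (Suc j) - G (Suc i) j)
        = G i (Suc j) - G i j + (G (Suc i) (Suc j) - G i (Suc j))" by simp
    show "G (Suc i) j - G i j \<noteq> G i (Suc j) - G i j"
      using inj[of "Suc i" j i "Suc j"] by auto
    show "G (Suc i) j - G i j + (G (Suc i) (Suc j) - G (Suc i) j) \<noteq> 0"
      using inj[of "Suc i" "Suc j" i j] by auto
  qed
  have row: "G (Suc i) j - G i j = G (Suc i) 0 - G i 0" for i j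
    by (induction j) (use step in auto)
  show ?thesis
  proof (induction i)
    case (Suc i)
    have "G (Suc i) j = (G (Suc i) j - G i j) + G i j" by simp
    also have "\<dots> = (G (Suc i) 0 - G i 0) + (G i 0 + G 0 j - G 0 0)"
      using row[of i j] Suc by (simp only:)
    also have "\<dots> = G (Suc i) 0 + G 0 j - G 0 0" by simp
    finally show ?case .
  qed simp
qed

text \<open>
  The competition behind the impossibility of 1-Lipschitz embeddings: \<open>K\<^sup>n K\<^sup>n\<close> counts pairs of
  paths of length \<open>n\<close>, while the pattern has to agree at \<open>n\<^sup>2\<close> sites.
\<close>

lemma ex_power_square_small:
  fixes q e :: real
  assumes "0 \<le> q" "q < 1" "0 < e" "0 \<le> K"
  shows "\<exists>n. (K ^ n * K ^ n) * q ^ (n * n) \<le> e"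
proof -
  have "(\<lambda>n. K\<^sup>2 * q ^ n) \<longlonglongrightarrow> K\<^sup>2 * 0"
    using assms by (intro tendsto_intros LIMSEQ_power_zero) auto
  then have "eventually (\<lambda>n. K\<^sup>2 * q ^ n < 1/2) sequentially"
    by (rule order_tendstoD) simp
  moreover have "eventually (\<lambda>n. (1/2::real) ^ n < e) sequentially"
    by (rule order_tendstoD[OF LIMSEQ_power_zero]) (use assms in auto)
  ultimately have "eventually (\<lambda>n. K\<^sup>2 * q ^ n < 1/2 \<and> (1/2::real) ^ n < e) sequentially"
    by (rule eventually_conj)
  then obtain n where n: "K\<^sup>2 * q ^ n < 1/2" "(1/2::real) ^ n < e"
    using eventually_happens'[OF sequentially_bot] by blast
  have "(K ^ n * K ^ n) * q ^ (n * n) = (K\<^sup>2 * q ^ n) ^ n"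
    by (simp add: power_mult_distrib power_mult power2_eq_square)
  also have "\<dots> \<le> (1/2) ^ n"
    using n assms by (intro power_mono) auto
  finally show ?thesis using n(2) by (intro exI[of _ n]) simp
qed

text \<open>
  Two coordinates suffice. By the splitting above, the image of an \<open>n \<times> n\<close> square under a
  1-Lipschitz embedding with given \<open>f 0\<close> is encoded by two words of \<open>n\<close> unit vectors.
\<close>

lemma no_1_Lip_embedding:
  fixes \<eta> :: "'d::finite config"
  assumes d: "CARD('d) \<ge> 2" and p: "0 < p" "p < 1"
  shows "AE \<omega>::'D::finite config in percolation p. \<not> (\<exists>f. Lip_embedding 1 \<eta> \<omega> f)"
proof -
  obtain i1 i2 :: 'd where i12: "i1 \<noteq> i2"
    using d card_le_Suc0_iff_eq[of "UNIV :: 'd set"] by fastforce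
  define x :: "nat \<Rightarrow> nat \<Rightarrow> int ^ 'd" where "x i j = axis i1 (int i) + axis i2 (int j)" for i j
  have x_inj: "x i j = x i' j' \<Longrightarrow> i = i' \<and> j = j'" for i j i' j'
  proof -
    assume eq: "x i j = x i' j'"
    from arg_cong[OF this, of "\<lambda>v. v $ i1"] arg_cong[OF this, of "\<lambda>v. v $ i2"]
    show "i = i' \<and> j = j'" using i12 by (simp add: x_def axis_def)
  qed
  have x0: "x 0 0 = 0" by (simp add: x_def vec_eq_iff axis_def)
  have x_hor: "x (Suc i) j - x i j = axis i1 1" and x_ver: "x i (Suc j) - x i j = axis i2 1" for i j
    by (auto simp: x_def vec_eq_iff axis_def)
  let ?U = "{u :: int ^ 'D. l1_norm u = 1}"
  define K where "K = real (card ?U)"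
  define q where "q = max p (1 - p)"
  have q: "0 \<le> q" "q < 1" using p by (auto simp: q_def)
  have "AE \<omega>::'D config in percolation p. \<not> (\<exists>f. f 0 = z \<and> Lip_embedding 1 \<eta> \<omega> f)" for z
  proof (rule AE_not_if_small_covers)
    fix e :: real assume "0 < e"
    then obtain n where n: "(K ^ n * K ^ n) * q ^ (n * n) \<le> e"
      using ex_power_square_small[OF q, of e K] K_def by auto
    define W where "W = {us. set us \<subseteq> ?U \<and> length us = n}"
    define pos where "pos w t = z + sum_list (take (fst t) (fst w)) + sum_list (take (snd t) (snd w))"
      for w :: "(int ^ 'D) list \<times> (int ^ 'D) list" and t
    define S where "S = {..<n} \<times> {..<n}"
    define WW where "WW = {w \<in> W \<times> W. inj_on (pos w) S}"
    define E where "E w = {\<omega>. \<forall>t\<in>S. \<omega> (pos w t) = \<eta> (x (fst t) (snd t))}" for w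
    have W: "finite W" "card W = card ?U ^ n"
      using finite_lists_length_eq[OF finite_units] card_lists_length_eq[OF finite_units]
      unfolding W_def by auto
    have WW: "finite WW" "real (card WW) \<le> K ^ n * K ^ n"
    proof -
      show "finite WW" unfolding WW_def using W by auto
      have "card WW \<le> card (W \<times> W)" unfolding WW_def using W by (intro card_mono) auto
      then show "real (card WW) \<le> K ^ n * K ^ n"
        using W(2) by (simp add: K_def card_cartesian_product flip: of_nat_power of_nat_mult)
    qed
    have S: "finite S" "card S = n * n" by (auto simp: S_def)
    have E: "E w \<in> sets (percolation p)" "measure (percolation p) (E w) \<le> q ^ (n * n)" if "w \<in> WW" for w
      using that prob_pattern_le[OF p S(1), of "pos w" "\<lambda>t. \<eta> (x (fst t) (snd t))"] S(2)
      unfolding E_def WW_def q_def by auto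
    show "\<exists>N\<in>sets (percolation p). {\<omega>. \<exists>f. f 0 = z \<and> Lip_embedding 1 \<eta> \<omega> f} \<subseteq> N
        \<and> measure (percolation p) N \<le> e"
    proof (intro bexI[of _ "\<Union>w\<in>WW. E w"] conjI)
      show "(\<Union>w\<in>WW. E w) \<in> sets (percolation p)"
        using E WW by (intro sets.finite_UN) auto
      have "measure (percolation p) (\<Union>w\<in>WW. E w) \<le> real (card WW) * q ^ (n * n)"
        using E WW by (intro prob_UN_le) auto
      also have "\<dots> \<le> (K ^ n * K ^ n) * q ^ (n * n)"
        using WW q by (intro mult_right_mono) auto
      finally show "measure (percolation p) (\<Union>w\<in>WW. E w) \<le> e" using n by simp
      show "{\<omega>. \<exists>f. f 0 = z \<and> Lip_embedding 1 \<eta> \<omega> f} \<subseteq> (\<Union>w\<in>WW. E w)"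
      proof
        fix \<omega> assume "\<omega> \<in> {\<omega>. \<exists>f. f 0 = z \<and> Lip_embedding 1 \<eta> \<omega> f}"
        then obtain f where f0: "f 0 = z" and f: "inj f" "\<And>x. \<eta> x = \<omega> (f x)" "Lip 1 f"
          unfolding Lip_embedding_def embedding_def by auto
        define G where "G i j = f (x i j)" for i j
        have G_inj: "G i j = G i' j' \<Longrightarrow> i = i' \<and> j = j'" for i j i' j'
          using x_inj injD[OF f(1)] unfolding G_def by blast
        have unit: "l1_norm (f a - f b) = 1" if "l1_norm (a - b) = 1" for a b
        proof -
          have "a \<noteq> b" using that by auto
          then have "f a - f b \<noteq> 0" using f(1) by (auto dest: injD)
          then have "l1_norm (f a - f b) \<noteq> 0" by (simp add: l1_norm_eq_0_iff)
          moreover have "l1_norm (f a - f b) \<le> 1" using f(3) that unfolding Lip_def by blast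
          ultimately show ?thesis using l1_norm_nonneg[of "f a - f b"] by linarith
        qed
        have hor: "l1_norm (G (Suc i) j - G i j) = 1" and ver: "l1_norm (G i (Suc j) - G i j) = 1" for i j
          unfolding G_def by (rule unit, simp add: x_hor x_ver l1_norm_axis)+
        note split = quadrant_image_splits[of G, OF G_inj hor ver]
        define us where "us = map (\<lambda>i. G (Suc i) 0 - G i 0) [0..<n]"
        define vs where "vs = map (\<lambda>j. G 0 (Suc j) - G 0 j) [0..<n]"
        have us: "sum_list (take i us) = G i 0 - G 0 0" if "i \<le> n" for i
          using that by (induction i) (auto simp: us_def take_Suc_conv_app_nth)
        have vs: "sum_list (take j vs) = G 0 j - G 0 0" if "j \<le> n" for j
          using that by (induction j) (auto simp: vs_def take_Suc_conv_app_nth)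
        have pos: "pos (us, vs) t = G (fst t) (snd t)" if "t \<in> S" for t
        proof -
          have "fst t \<le> n" "snd t \<le> n" using that unfolding S_def by auto
          moreover have "G 0 0 = z" by (simp add: G_def x0 f0)
          ultimately show ?thesis
            using us vs split[of "fst t" "snd t"] by (simp add: pos_def)
        qed
        have "inj_on (pos (us, vs)) S"
          by (rule inj_onI) (use pos G_inj in \<open>metis prod.collapse\<close>)
        then have "(us, vs) \<in> WW"
          unfolding WW_def W_def using hor ver by (auto simp: us_def vs_def)
        moreover have "\<omega> \<in> E (us, vs)"
          unfolding E_def using pos f(2) by (simp add: G_def)
        ultimately show "\<omega> \<in> (\<Union>w\<in>WW. E w)" by blast
      qed
    qed
  qed
  then have "AE \<omega>::'D config in percolation p. \<forall>z. \<not> (\<exists>f. f 0 = z \<and> Lip_embedding 1 \<eta> \<omega> f)"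
    by (subst AE_all_countable) auto
  then show ?thesis by eventually_elim auto
qed

section \<open>Lipschitz surfaces avoiding a sparse random set\<close>

text \<open>
  Points of the lattice of one more dimension are pairs \<open>(x, h)\<close> with a height \<open>h\<close>. The set
  \<open>B\<close> is to be avoided. A step goes up only into \<open>B\<close>, but may always go down, with at most one
  horizontal unit. The first unreachable height over \<open>x\<close> is then outside \<open>B\<close>, because
  otherwise one could step up to it, and downward steps carry reachability to neighbouring columns,
  which makes this height 1-Lipschitz. If \<open>B\<close> is sparse, high points are unlikely to be reached:
  at least half of the steps of a path that climbs must end at distinct points of \<open>B\<close>.
\<close>

definition surface_step :: "((int ^ 'd::finite) \<times> int) set \<Rightarrow> (int ^ 'd) \<times> int \<Rightarrow> (int ^ 'd) \<times> int \<Rightarrow> bool" where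
  "surface_step B a b \<longleftrightarrow>
     b = (fst a, snd a + 1) \<and> b \<in> B \<or> l1_norm (fst b - fst a) \<le> 1 \<and> snd b = snd a - 1"

definition reachable :: "((int ^ 'd::finite) \<times> int) set \<Rightarrow> (int ^ 'd) \<times> int \<Rightarrow> bool" where
  "reachable B b \<longleftrightarrow> (\<exists>y. (surface_step B)\<^sup>*\<^sup>* (y, 0) b)"

lemma reachable_step: "reachable B a \<Longrightarrow> surface_step B a b \<Longrightarrow> reachable B b"
  unfolding reachable_def by (meson rtranclp.rtrancl_into_rtrancl)

lemma reachable_mono:
  assumes "reachable B (x, int n)" "m \<le> n"
  shows "reachable B (x, int m)"
  using assms(2,1)
proof (induction rule: inc_induct)
  case (step k)
  have "surface_step B (x, int (Suc k)) (x, int k)" by (simp add: surface_step_def)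
  with step show ?case using reachable_step by blast
qed

lemma Lipschitz_surface_if_bounded_reach:
  assumes "\<And>x. \<exists>n::nat. \<not> reachable B (x, int n)"
  obtains F where "\<And>x. (x, F x) \<notin> B" "\<And>x y. l1_norm (x - y) = 1 \<Longrightarrow> \<bar>F x - F y\<bar> \<le> 1"
proof -
  define N where "N x = (LEAST n. \<not> reachable B (x, int n))" for x
  have N: "\<not> reachable B (x, int (N x))" for x
    unfolding N_def by (rule LeastI_ex[OF assms])
  have below: "reachable B (x, int n) \<longleftrightarrow> n < N x" for x n
    using N reachable_mono not_less_Least[of n "\<lambda>n. \<not> reachable B (x, int n)"]
    unfolding N_def by (meson not_le)
  have "reachable B (x, int 0)" for x
    unfolding reachable_def by auto
  then have pos: "0 < N x" for x using below by blast
  have top: "reachable B (x, int (N x) - 1)" for x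
    using below[of x "N x - 1"] pos[of x] by (simp add: of_nat_diff)
  show thesis
  proof
    show "(x, int (N x)) \<notin> B" for x
    proof
      assume "(x, int (N x)) \<in> B"
      then have "surface_step B (x, int (N x) - 1) (x, int (N x))" by (simp add: surface_step_def)
      then show False using top N reachable_step by blast
    qed
    \<comment> \<open>Going down from the highest reachable point over \<open>x\<close> reaches height \<open>N x - 2\<close> over \<open>y\<close>.\<close>
    have le: "int (N x) \<le> int (N y) + 1" if "l1_norm (x - y) = 1" for x y
    proof (cases "N x \<ge> 2")
      case True
      have "surface_step B (x, int (N x) - 1) (y, int (N x - 2))"
        using that True by (simp add: surface_step_def l1_norm_minus_commute of_nat_diff)
      then have "N x - 2 < N y" using top reachable_step below by blast
      then show ?thesis by linarith
    qed auto
    show "\<bar>int (N x) - int (N y)\<bar> \<le> 1" if "l1_norm (x - y) = 1" for x y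
      using le[of x y] le[of y x] that by (simp add: l1_norm_minus_commute)
  qed
qed

text \<open>
  Paths are traced backwards from their endpoint \<open>a\<close>; \<open>ups a ps\<close> collects the endpoints of the
  upward steps, which are the points that a path forces into \<open>B\<close>.
\<close>

fun ups :: "'a \<times> int \<Rightarrow> ('a \<times> int) list \<Rightarrow> ('a \<times> int) set" where
  "ups a [] = {}"
| "ups a (b # ps) = (if snd a = snd b + 1 then {a} else {}) \<union> ups b ps"

lemma ups_subset: "ups a ps \<subseteq> set (a # ps)"
  by (induction a ps rule: ups.induct) auto

lemma finite_ups: "finite (ups a ps)"
  by (rule finite_subset[OF ups_subset]) simp

lemma ups_subset_bad: "rtrancl_path (surface_step B)\<inverse>\<inverse> a ps w \<Longrightarrow> ups a ps \<subseteq> B"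
  by (induction rule: rtrancl_path.induct) (auto simp: surface_step_def)

text \<open>
  Every step changes the height by exactly one, so length and height difference determine the
  number of upward steps. On a path without repeated points these end at distinct points.
\<close>

lemma card_ups:
  "rtrancl_path (surface_step B)\<inverse>\<inverse> a ps w \<Longrightarrow> distinct (a # ps) \<Longrightarrow>
    2 * int (card (ups a ps)) = int (length ps) + snd a - snd w"
proof (induction rule: rtrancl_path.induct)
  case (step a b ps w)
  have "a \<notin> ups b ps" using ups_subset[of b ps] step.prems by auto
  then have "int (card (ups a (b # ps))) = (if snd a = snd b + 1 then 1 else 0) + int (card (ups b ps))"
    using finite_ups[of b ps] by simp
  then show ?case using step by (auto simp: surface_step_def)
qed simp

lemma rtrancl_path_mono:
  "rtrancl_path r a ps w \<Longrightarrow> (\<And>x y. r x y \<Longrightarrow> r' x y) \<Longrightarrow> rtrancl_path r' a ps w"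
  by (induction rule: rtrancl_path.induct) (auto intro: rtrancl_path.intros)

definition walks :: "nat \<Rightarrow> (int ^ 'd::finite) \<times> int \<Rightarrow> ((int ^ 'd) \<times> int) list set" where
  "walks n a = {ps. length ps = n \<and> (\<exists>w. rtrancl_path (surface_step UNIV)\<inverse>\<inverse> a ps w)}"

lemma card_walks_le:
  fixes a :: "(int ^ 'd::finite) \<times> int"
  assumes K: "\<And>a :: (int ^ 'd) \<times> int. finite {b. surface_step UNIV b a}"
    "\<And>a :: (int ^ 'd) \<times> int. card {b. surface_step UNIV b a} \<le> K"
  shows "finite (walks n a) \<and> card (walks n a) \<le> K ^ n"
proof (induction n arbitrary: a)
  case 0
  have "rtrancl_path (surface_step UNIV)\<inverse>\<inverse> a [] a" by (rule rtrancl_path.base)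
  then have "walks 0 a = {[]}" unfolding walks_def by blast
  then show ?case by simp
next
  case (Suc n)
  let ?N = "{b. surface_step UNIV b a}"
  have sub: "walks (Suc n) a \<subseteq> (\<Union>b\<in>?N. Cons b ` walks n b)"
  proof
    fix qs assume "qs \<in> walks (Suc n) a"
    then obtain w where len: "length qs = Suc n"
      and path: "rtrancl_path (surface_step UNIV)\<inverse>\<inverse> a qs w"
      unfolding walks_def by blast
    from path show "qs \<in> (\<Union>b\<in>?N. Cons b ` walks n b)"
    proof cases
      case (step b ps)
      then have "ps \<in> walks n b" using len unfolding walks_def by (intro CollectI conjI exI) auto
      then show ?thesis using step by blast
    qed (use len in simp)
  qed
  have fin: "finite (\<Union>b\<in>?N. Cons b ` walks n b)"
    using K(1) Suc by (intro finite_UN_I finite_imageI) blast+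
  have "card (walks (Suc n) a) \<le> card (\<Union>b\<in>?N. Cons b ` walks n b)"
    by (rule card_mono[OF fin sub])
  also have "\<dots> \<le> (\<Sum>b\<in>?N. card (Cons b ` walks n b))"
    by (rule card_UN_le[OF K(1)])
  also have "\<dots> \<le> (\<Sum>b\<in>?N. K ^ n)"
    using Suc by (intro sum_mono) (meson card_image_le order_trans)
  also have "\<dots> \<le> K ^ Suc n" using K(2)[of a] by simp
  finally show ?case using finite_subset[OF sub fin] by blast
qed

text \<open>
  Steps go between neighbouring points, so the number of backward paths grows at most exponentially
  with their length.
\<close>

lemma ex_branching_bound:
  "\<exists>K>0. \<forall>a :: (int ^ 'd::finite) \<times> int.
     finite {b. surface_step UNIV b a} \<and> card {b. surface_step UNIV b a} \<le> K"
proof -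
  define U where "U = insert 0 {u :: int ^ 'd. l1_norm u = 1}"
  have U: "finite U" unfolding U_def using finite_units by simp
  have "finite {b. surface_step UNIV b a} \<and> card {b. surface_step UNIV b a} \<le> Suc (card U)"
    for a :: "(int ^ 'd) \<times> int"
  proof -
    have "{b. surface_step UNIV b a} \<subseteq> insert (fst a, snd a - 1) ((\<lambda>u. (fst a - u, snd a + 1)) ` U)"
      (is "_ \<subseteq> ?R")
    proof
      fix b assume "b \<in> {b. surface_step UNIV b a}"
      then consider "a = (fst b, snd b + 1)" | "l1_norm (fst a - fst b) \<le> 1" "snd a = snd b - 1"
        unfolding surface_step_def by auto
      then show "b \<in> ?R"
      proof cases
        case 1
        then have "b = (fst a, snd a - 1)" by (cases a; cases b; simp)
        then show ?thesis by simp
      next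
        case 2
        then have "l1_norm (fst a - fst b) = 0 \<or> l1_norm (fst a - fst b) = 1"
          using l1_norm_nonneg[of "fst a - fst b"] by linarith
        then have "fst a - fst b \<in> U" unfolding U_def l1_norm_eq_0_iff by auto
        moreover have "b = (fst a - (fst a - fst b), snd a + 1)" using 2 by (cases b) simp
        ultimately show ?thesis by blast
      qed
    qed
    moreover have "finite ?R" using U by simp
    moreover have "card ?R \<le> Suc (card U)"
    proof -
      have "card ?R \<le> Suc (card ((\<lambda>u. (fst a - u, snd a + 1)) ` U))"
        using U by (simp add: card_insert_if)
      also have "\<dots> \<le> Suc (card U)" using card_image_le[OF U] by simp
      finally show ?thesis .
    qed
    ultimately show ?thesis by (meson card_mono finite_subset order_trans)
  qed
  then show ?thesis by (intro exI[of _ "Suc (card U)"]) auto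
qed

text \<open>
  A Peierls argument. A backward path of length \<open>n\<close> from \<open>(x, h)\<close> to height \<open>0\<close> has
  \<open>(n + h) / 2\<close> upward steps, so it occurs with probability at most \<open>\<delta>\<^sup>n\<^sup>+\<^sup>h\<close>. There are at
  most \<open>K\<^sup>n\<close> such paths, and summation over \<open>n\<close> gives \<open>2 \<delta>\<^sup>h\<close>.
\<close>

lemma AE_bounded_reach:
  fixes bad :: "'D::finite config \<Rightarrow> (int ^ 'd::finite) \<times> int \<Rightarrow> bool"
  assumes K: "\<And>a :: (int ^ 'd) \<times> int. finite {b. surface_step UNIV b a}"
      "\<And>a :: (int ^ 'd) \<times> int. card {b. surface_step UNIV b a} \<le> K"
    and \<delta>: "0 < \<delta>" "\<delta> < 1" "real K * \<delta> \<le> 1/2"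
    and meas: "\<And>S. finite S \<Longrightarrow> {\<omega>. \<forall>u\<in>S. bad \<omega> u} \<in> sets (percolation p)"
    and prob: "\<And>S. finite S \<Longrightarrow> measure (percolation p) {\<omega>. \<forall>u\<in>S. bad \<omega> u} \<le> (\<delta>\<^sup>2) ^ card S"
  shows "AE \<omega> in percolation p. \<forall>x. \<exists>n::nat. \<not> reachable {u. bad \<omega> u} (x, int n)"
proof -
  interpret M: prob_space "percolation p :: 'D config measure" by (rule prob_space_percolation)
  have "AE \<omega> in percolation p. \<not> (\<forall>n::nat. reachable {u. bad \<omega> u} (x, int n))" for x
  proof (rule AE_not_if_small_covers)
    fix e :: real assume "0 < e"
    then have "eventually (\<lambda>h. \<delta> ^ h < e / 2) sequentially"
      by (intro order_tendstoD[OF LIMSEQ_power_zero]) (use \<delta> in auto)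
    then obtain h where h: "\<delta> ^ h < e / 2"
      using eventually_happens'[OF sequentially_bot] by blast
    define W where "W n = {ps \<in> walks n (x, int h). 2 * card (ups (x, int h) ps) = n + h}" for n
    define E where "E n = (\<Union>ps\<in>W n. {\<omega>. \<forall>u\<in>ups (x, int h) ps. bad \<omega> u})" for n
    have W: "finite (W n)" "card (W n) \<le> K ^ n" for n
      using card_walks_le[OF K, of n "(x, int h)"] card_mono[of "walks n (x, int h)" "W n"]
      unfolding W_def by auto
    have E_meas: "E n \<in> sets (percolation p)" for n
      unfolding E_def by (rule sets.finite_UN[OF W(1) meas[OF finite_ups]])
    have E_prob: "measure (percolation p) (E n) \<le> \<delta> ^ h * (1/2) ^ n" for n
    proof -
      have "measure (percolation p) (E n) \<le> real (card (W n)) * \<delta> ^ (n + h)"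
        unfolding E_def
      proof (rule prob_UN_le)
        fix ps assume "ps \<in> W n"
        then have "2 * card (ups (x, int h) ps) = n + h" unfolding W_def by simp
        then have "(\<delta>\<^sup>2) ^ card (ups (x, int h) ps) = \<delta> ^ (n + h)"
          by (simp flip: power_mult)
        then show "measure (percolation p) {\<omega>. \<forall>u\<in>ups (x, int h) ps. bad \<omega> u} \<le> \<delta> ^ (n + h)"
          using prob[OF finite_ups, of "(x, int h)" ps] by simp
      qed (rule W(1), rule meas[OF finite_ups])
      also have "\<dots> \<le> real (K ^ n) * \<delta> ^ (n + h)"
        using W(2)[of n] \<delta> by (intro mult_right_mono) auto
      also have "\<dots> = \<delta> ^ h * (real K * \<delta>) ^ n"
        by (simp add: power_add power_mult_distrib)
      also have "\<dots> \<le> \<delta> ^ h * (1/2) ^ n"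
        using \<delta> by (intro mult_left_mono power_mono) auto
      finally show ?thesis .
    qed
    have sums: "(\<lambda>n. \<delta> ^ h * (1/2) ^ n) sums (\<delta> ^ h * 2)"
      using geometric_sums[of "1/2::real"] by (intro sums_mult) simp
    have summ: "summable (\<lambda>n. measure (percolation p) (E n))"
      by (rule summable_comparison_test'[OF sums_summable[OF sums]]) (use E_prob in auto)
    show "\<exists>N\<in>sets (percolation p).
        {\<omega>. \<forall>n::nat. reachable {u. bad \<omega> u} (x, int n)} \<subseteq> N \<and> measure (percolation p) N \<le> e"
    proof (intro bexI[of _ "\<Union>n. E n"] conjI)
      have "measure (percolation p) (\<Union>n. E n) \<le> (\<Sum>n. measure (percolation p) (E n))"
        using E_meas summ by (intro M.finite_measure_subadditive_countably) auto
      also have "\<dots> \<le> (\<Sum>n. \<delta> ^ h * (1/2) ^ n)"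
        by (rule suminf_le[OF E_prob summ sums_summable[OF sums]])
      also have "\<dots> = \<delta> ^ h * 2" using sums by (rule sums_unique[symmetric])
      finally show "measure (percolation p) (\<Union>n. E n) \<le> e" using h by simp
      show "{\<omega>. \<forall>n::nat. reachable {u. bad \<omega> u} (x, int n)} \<subseteq> (\<Union>n. E n)"
      proof
        fix \<omega> assume "\<omega> \<in> {\<omega>. \<forall>n::nat. reachable {u. bad \<omega> u} (x, int n)}"
        then obtain y where "(surface_step {u. bad \<omega> u})\<^sup>*\<^sup>* (y, 0) (x, int h)"
          unfolding reachable_def by blast
        then have "(surface_step {u. bad \<omega> u})\<inverse>\<inverse>\<^sup>*\<^sup>* (x, int h) (y, 0)"
          by (simp add: rtranclp_conversep)
        then obtain qs where "rtrancl_path (surface_step {u. bad \<omega> u})\<inverse>\<inverse> (x, int h) qs (y, 0)"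
          using rtranclp_eq_rtrancl_path by metis
        then obtain ps where ps: "rtrancl_path (surface_step {u. bad \<omega> u})\<inverse>\<inverse> (x, int h) ps (y, 0)"
          "distinct ((x, int h) # ps)"
          by (rule rtrancl_path_distinct)
        have "rtrancl_path (surface_step UNIV)\<inverse>\<inverse> (x, int h) ps (y, 0)"
          using ps(1) by (rule rtrancl_path_mono) (auto simp: surface_step_def)
        then have "ps \<in> W (length ps)"
          using card_ups[OF ps] unfolding W_def walks_def by auto
        moreover have "\<forall>u\<in>ups (x, int h) ps. bad \<omega> u"
          using ups_subset_bad[OF ps(1)] by auto
        ultimately show "\<omega> \<in> (\<Union>n. E n)" unfolding E_def by blast
      qed
    qed (use E_meas in auto)
  qed
  then have "AE \<omega> in percolation p. \<forall>x. \<not> (\<forall>n::nat. reachable {u. bad \<omega> u} (x, int n))"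
    by (subst AE_all_countable) auto
  then show ?thesis by simp
qed

section \<open>Embedding into a higher-dimensional lattice\<close>

lemma sum_over_embedded_coordinates:
  fixes \<iota> :: "'d::finite \<Rightarrow> 'D::finite" and g :: "'d \<Rightarrow> int"
  assumes "inj \<iota>" "e0 \<notin> range \<iota>"
  shows "(\<Sum>j\<in>UNIV. if j = e0 then k else if j \<in> range \<iota> then g (inv \<iota> j) else 0) = k + (\<Sum>i\<in>UNIV. g i)"
proof -
  have "(\<Sum>j\<in>UNIV. if j = e0 then k else if j \<in> range \<iota> then g (inv \<iota> j) else 0)
      = (\<Sum>j\<in>insert e0 (range \<iota>). if j = e0 then k else if j \<in> range \<iota> then g (inv \<iota> j) else 0)"
    by (rule sum.mono_neutral_right) auto
  also have "\<dots> = k + (\<Sum>j\<in>range \<iota>. g (inv \<iota> j))"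
    using assms(2) by (subst sum.insert) (auto intro!: sum.cong)
  also have "(\<Sum>j\<in>range \<iota>. g (inv \<iota> j)) = (\<Sum>i\<in>UNIV. g i)"
    using assms(1) by (subst sum.reindex) auto
  finally show ?thesis .
qed

text \<open>
  One coordinate \<open>e0\<close> outside the image of \<open>\<iota>\<close> serves as the height. The vertical lines are cut into
  blocks of \<open>L\<close> consecutive sites, and a block is bad if it does not contain both states. For large
  \<open>L\<close> bad blocks are rare enough for a Lipschitz surface of good blocks to exist, and inside
  the good block over \<open>x\<close> a site with the state \<open>\<eta> x\<close> can be chosen for every \<open>\<eta>\<close>.
\<close>

lemma Lip_embedding_in_higher_dimension:
  assumes dD: "CARD('d::finite) < CARD('D::finite)" and p: "0 < p" "p < 1"
  shows "\<exists>M\<ge>1. AE \<omega>::'D config in percolation p. \<forall>\<eta>::'d config. \<exists>f. Lip_embedding M \<eta> \<omega> f"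
proof -
  obtain \<iota> :: "'d \<Rightarrow> 'D" where \<iota>: "inj \<iota>"
    using inj_on_iff_card_le[of "UNIV :: 'd set" "UNIV :: 'D set"] dD by auto
  have "range \<iota> \<noteq> UNIV"
    using dD card_image[OF \<iota>] by auto
  then obtain e0 where e0: "e0 \<notin> range \<iota>" by blast
  define site :: "int ^ 'd \<Rightarrow> int \<Rightarrow> int ^ 'D" where
    "site x h = (\<chi> j. if j = e0 then h else if j \<in> range \<iota> then x $ inv \<iota> j else 0)" for x h
  have site_norm: "l1_norm (site x h - site y k) = \<bar>h - k\<bar> + l1_norm (x - y)" for x y h k
  proof -
    have "l1_norm (site x h - site y k) = (\<Sum>j\<in>UNIV. if j = e0 then \<bar>h - k\<bar>
        else if j \<in> range \<iota> then \<bar>(x - y) $ inv \<iota> j\<bar> else 0)"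
      unfolding l1_norm_def site_def by (intro sum.cong) auto
    then show ?thesis
      using sum_over_embedded_coordinates[OF \<iota> e0, of "\<bar>h - k\<bar>" "\<lambda>i. \<bar>(x - y) $ i\<bar>"]
      unfolding l1_norm_def by simp
  qed
  have site_inj: "x = y \<and> h = k" if "site x h = site y k" for x y h k
  proof -
    have "\<bar>h - k\<bar> + l1_norm (x - y) = 0" using site_norm[of x h y k] that by simp
    then have "h = k" "l1_norm (x - y) = 0" using l1_norm_nonneg[of "x - y"] by linarith+
    then show ?thesis by (simp add: l1_norm_eq_0_iff)
  qed
  obtain K where K: "0 < K" "\<And>a :: (int ^ 'd) \<times> int. finite {b. surface_step UNIV b a}"
      "\<And>a :: (int ^ 'd) \<times> int. card {b. surface_step UNIV b a} \<le> K"
    using ex_branching_bound[where 'd='d] by auto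
  define \<delta> where "\<delta> = 1 / (2 * real K)"
  have \<delta>: "0 < \<delta>" "\<delta> < 1" "real K * \<delta> \<le> 1/2" using K(1) by (auto simp: \<delta>_def field_simps)
  define q where "q = max p (1 - p)"
  have q: "0 \<le> q" "q < 1" using p by (auto simp: q_def)
  have "eventually (\<lambda>L. q ^ L < \<delta>\<^sup>2 / 2) sequentially"
    by (intro order_tendstoD[OF LIMSEQ_power_zero]) (use q \<delta> in auto)
  then have "eventually (\<lambda>L. q ^ L < \<delta>\<^sup>2 / 2 \<and> 1 \<le> L) sequentially"
    by (intro eventually_conj eventually_ge_at_top)
  then obtain L where L: "q ^ L < \<delta>\<^sup>2 / 2" "1 \<le> L"
    using eventually_happens'[OF sequentially_bot] by blast
  define pos where "pos u a = site (fst u) (int L * snd u + int a)" for u and a :: nat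
  have pos_inj: "u = v \<and> a = b" if "pos u a = pos v b" "a < L" "b < L" for u v a b
  proof -
    have 1: "fst u = fst v" and 2: "int L * snd u + int a = int L * snd v + int b"
      using site_inj that(1) unfolding pos_def by blast+
    have "snd u = (int L * snd u + int a) div int L" using that(2) by simp
    also have "\<dots> = snd v" unfolding 2 using that(3) by simp
    finally show ?thesis using 1 2 by (simp add: prod_eq_iff)
  qed
  define column where "column u = pos u ` {..<L}" for u
  define bad where "bad \<omega> u \<longleftrightarrow> (\<exists>c. \<forall>a<L. \<omega> (pos u a) = c)" for \<omega> :: "'D config" and u
  have det: "determined_by (column u) (\<lambda>\<omega>. bad \<omega> u)" for u
    unfolding determined_by_def bad_def column_def by auto
  have det_all: "determined_by (\<Union>u\<in>S. column u) (\<lambda>\<omega>. \<forall>u\<in>S. bad \<omega> u)" for S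
    using det unfolding determined_by_def by (metis UN_I)
  have fin: "finite (column u)" for u unfolding column_def by simp
  have dis: "disjoint_family_on column S" for S
    unfolding disjoint_family_on_def column_def using pos_inj by blast
  have prob_bad: "measure (percolation p) {\<omega>. bad \<omega> u} \<le> \<delta>\<^sup>2" for u
  proof -
    have inj: "inj_on (pos u) {..<L}" by (rule inj_onI) (use pos_inj in blast)
    have eq: "{\<omega>. bad \<omega> u} = (\<Union>c\<in>UNIV. {\<omega>. \<forall>a\<in>{..<L}. \<omega> (pos u a) = c})"
      unfolding bad_def by auto
    have "measure (percolation p) {\<omega>. bad \<omega> u} \<le> real CARD(bool) * q ^ L"
      unfolding eq q_def
      using prob_pattern_le[OF p _ inj, of "\<lambda>_. c" for c] by (intro prob_UN_le) auto
    then show ?thesis using L(1) by simp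
  qed
  have "AE \<omega> in percolation p. \<forall>x. \<exists>n::nat. \<not> reachable {u. bad \<omega> u} (x, int n)"
  proof (rule AE_bounded_reach[OF K(2,3) \<delta>])
    fix S :: "((int ^ 'd) \<times> int) set" assume S: "finite S"
    show "{\<omega>. \<forall>u\<in>S. bad \<omega> u} \<in> sets (percolation p)"
      by (rule sets_determined_by[OF p _ det_all]) (use S fin in auto)
    have "measure (percolation p) {\<omega>. \<forall>u\<in>S. bad \<omega> u} = (\<Prod>u\<in>S. measure (percolation p) {\<omega>. bad \<omega> u})"
      by (rule prob_disjoint_blocks[OF p S fin dis det])
    also have "\<dots> \<le> (\<Prod>u\<in>S. \<delta>\<^sup>2)"
      using prob_bad by (intro prod_mono) auto
    finally show "measure (percolation p) {\<omega>. \<forall>u\<in>S. bad \<omega> u} \<le> (\<delta>\<^sup>2) ^ card S" by simp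
  qed
  moreover have "\<exists>f. Lip_embedding (3 * int L) \<eta> \<omega> f"
    if reach: "\<forall>x. \<exists>n::nat. \<not> reachable {u. bad \<omega> u} (x, int n)" for \<omega> :: "'D config" and \<eta> :: "'d config"
  proof -
    obtain F where F: "\<And>x. (x, F x) \<notin> {u. bad \<omega> u}" "\<And>x y. l1_norm (x - y) = 1 \<Longrightarrow> \<bar>F x - F y\<bar> \<le> 1"
      using Lipschitz_surface_if_bounded_reach[OF reach[THEN spec]] by blast
    have "\<exists>a<L. \<omega> (pos (x, F x) a) = \<eta> x" for x
    proof (rule ccontr)
      assume "\<not> (\<exists>a<L. \<omega> (pos (x, F x) a) = \<eta> x)"
      then have "\<forall>a<L. \<omega> (pos (x, F x) a) = (\<not> \<eta> x)" by blast
      then show False using F(1)[of x] unfolding bad_def by blast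
    qed
    then obtain a where a: "\<And>x. a x < L" "\<And>x. \<omega> (pos (x, F x) (a x)) = \<eta> x" by metis
    define f where "f x = pos (x, F x) (a x)" for x
    have "inj f" unfolding f_def by (rule injI) (use pos_inj a(1) in blast)
    moreover have "Lip (3 * int L) f"
      unfolding Lip_def
    proof (intro allI impI)
      fix x y :: "int ^ 'd" assume xy: "l1_norm (x - y) = 1"
      have "l1_norm (f x - f y) = \<bar>(int L * F x + int (a x)) - (int L * F y + int (a y))\<bar> + 1"
        using xy by (simp add: f_def pos_def site_norm)
      also have "\<dots> \<le> \<bar>int L * (F x - F y)\<bar> + \<bar>int (a x) - int (a y)\<bar> + 1"
        by (simp add: algebra_simps)
      also have "\<bar>int L * (F x - F y)\<bar> \<le> int L * 1"
        unfolding abs_mult using F(2)[OF xy] by (intro mult_mono) auto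
      also have "\<bar>int (a x) - int (a y)\<bar> \<le> int L" using a(1)[of x] a(1)[of y] by linarith
      finally show "l1_norm (f x - f y) \<le> 3 * int L" using L(2) by simp
    qed
    ultimately show ?thesis
      unfolding Lip_embedding_def embedding_def using a(2) by (auto simp: f_def)
  qed
  ultimately show ?thesis
    using L(2) by (intro exI[of _ "3 * int L"]) (auto elim: AE_mp)
qed

section \<open>A Hex lemma\<close>

definition int_cube :: "int ^ 'n::finite \<Rightarrow> int \<Rightarrow> (int ^ 'n) set" where
  "int_cube c r = {v. \<forall>i. \<bar>v $ i - c $ i\<bar> \<le> r}"

lemma int_cube_subset_image:
  "int_cube c r \<subseteq> vec_lambda ` (\<Pi>\<^sub>E i\<in>UNIV. {c $ i - r .. c $ i + r})"
proof
  fix v assume "v \<in> int_cube c r"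
  then have "c $ i - r \<le> v $ i \<and> v $ i \<le> c $ i + r" for i
    unfolding int_cube_def by (simp add: abs_le_iff algebra_simps)
  then have "vec_nth v \<in> (\<Pi>\<^sub>E i\<in>UNIV. {c $ i - r .. c $ i + r})"
    by (simp add: PiE_UNIV_domain)
  then show "v \<in> vec_lambda ` (\<Pi>\<^sub>E i\<in>UNIV. {c $ i - r .. c $ i + r})"
    by (metis image_eqI vec_nth_inverse)
qed

lemma finite_int_cube: "finite (int_cube c r)"
  by (rule finite_subset[OF int_cube_subset_image]) (intro finite_imageI finite_PiE, auto)

lemma card_int_cube_le:
  fixes c :: "int ^ 'n::finite"
  assumes "0 \<le> r"
  shows "card (int_cube c r) \<le> nat (2 * r + 1) ^ CARD('n)"
proof -
  let ?P = "\<Pi>\<^sub>E i\<in>UNIV. {c $ i - r .. c $ i + r}"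
  have "card (int_cube c r) \<le> card (vec_lambda ` ?P)"
    by (rule card_mono[OF _ int_cube_subset_image]) (intro finite_imageI finite_PiE, auto)
  also have "\<dots> \<le> card ?P" by (rule card_image_le) (intro finite_PiE, auto)
  also have "\<dots> = nat (2 * r + 1) ^ CARD('n)" by (simp add: card_PiE)
  finally show ?thesis .
qed

text \<open>
  Consecutive points of a monochromatic path in the box \<open>{0..p}\<^sup>n\<close>, where diagonal
  neighbours count as adjacent. There are as many colours as coordinates.
\<close>

definition colour_link :: "int \<Rightarrow> (int ^ 'n::finite \<Rightarrow> 'n) \<Rightarrow> int ^ 'n \<Rightarrow> int ^ 'n \<Rightarrow> bool" where
  "colour_link p \<kappa> v w \<longleftrightarrow> (\<forall>i. v $ i \<in> {0..p}) \<and> (\<forall>i. w $ i \<in> {0..p}) \<and>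
     (\<forall>i. \<bar>v $ i - w $ i\<bar> \<le> 1) \<and> \<kappa> v = \<kappa> w"

lemma colour_link_rtrancl_same:
  "(colour_link p \<kappa>)\<^sup>*\<^sup>* v w \<Longrightarrow> \<kappa> w = \<kappa> v"
  by (induction rule: rtranclp_induct) (auto simp: colour_link_def)

text \<open>
  A continuous bump around the lattice point \<open>v\<close>. Two lattice points whose bumps are positive
  at the same \<open>x\<close> differ by at most one in each coordinate.
\<close>

definition tent :: "int ^ 'n::finite \<Rightarrow> real ^ 'n \<Rightarrow> real" where
  "tent v x = (\<Prod>j\<in>UNIV. max 0 (1 - \<bar>x $ j - real_of_int (v $ j)\<bar>))"

lemma tent_nonneg: "0 \<le> tent v x"
  unfolding tent_def by (intro prod_nonneg) auto

lemma tent_pos_iff: "0 < tent v x \<longleftrightarrow> (\<forall>j. \<bar>x $ j - real_of_int (v $ j)\<bar> < 1)"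
proof
  assume pos: "0 < tent v x"
  show "\<forall>j. \<bar>x $ j - real_of_int (v $ j)\<bar> < 1"
  proof (rule ccontr)
    assume "\<not> ?thesis"
    then obtain j where "1 \<le> \<bar>x $ j - real_of_int (v $ j)\<bar>" by (auto simp: not_less)
    then have "max 0 (1 - \<bar>x $ j - real_of_int (v $ j)\<bar>) = 0" by simp
    then have "tent v x = 0" unfolding tent_def by (intro prod_zero) auto
    then show False using pos by simp
  qed
next
  assume near: "\<forall>j. \<bar>x $ j - real_of_int (v $ j)\<bar> < 1"
  have "0 < max 0 (1 - \<bar>x $ j - real_of_int (v $ j)\<bar>)" for j
    using near[THEN spec, of j] by linarith
  then show "0 < tent v x" unfolding tent_def by (intro prod_pos) blast
qed

text \<open>
  In a colouring of a box with one colour for each coordinate direction, some colour \<open>i\<close> connects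
  the two faces orthogonal to direction \<open>i\<close>. Otherwise let each lattice point of colour \<open>i\<close>
  move by one unit in direction \<open>i\<close>, forward if it is connected to the lower face and backward if
  not. Blending these moves with the tents and truncating gives a continuous self-map of the box.
  Near any point \<open>x\<close> all moves in a given direction agree in sign, so they cannot cancel, and the
  truncation cannot stop them since points on a face move inwards. Hence there is no fixed point,
  contrary to Brouwer's theorem.
\<close>

lemma hex:
  fixes \<kappa> :: "int ^ 'n::finite \<Rightarrow> 'n"
  assumes p: "0 \<le> p"
  shows "\<exists>v w. (\<forall>i. v $ i \<in> {0..p}) \<and> (colour_link p \<kappa>)\<^sup>*\<^sup>* v w \<and> v $ \<kappa> v = 0 \<and> w $ \<kappa> v = p"
proof (rule ccontr)
  assume no_crossing: "\<not> ?thesis"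
  define box where "box = {v :: int ^ 'n. \<forall>i. v $ i \<in> {0..p}}"
  define A where "A = {w \<in> box. \<exists>v\<in>box. v $ \<kappa> v = 0 \<and> (colour_link p \<kappa>)\<^sup>*\<^sup>* v w}"
  have "\<bar>v $ i - 0 $ i\<bar> \<le> p" if "\<forall>i. v $ i \<in> {0..p}" for v :: "int ^ 'n" and i
    using that[THEN spec, of i] by simp
  then have "box \<subseteq> int_cube 0 p" unfolding box_def int_cube_def by blast
  then have fin: "finite box" using finite_int_cube finite_subset by blast
  have A_low: "v \<in> A" if "v \<in> box" "v $ \<kappa> v = 0" for v
    using that unfolding A_def by auto
  have A_high: "v $ \<kappa> v \<noteq> p" if v: "v \<in> A" for v
  proof -
    obtain u where "u \<in> box" "u $ \<kappa> u = 0" and path: "(colour_link p \<kappa>)\<^sup>*\<^sup>* u v"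
      using v unfolding A_def by blast
    then have "v $ \<kappa> u \<noteq> p" using no_crossing unfolding box_def by blast
    then show ?thesis using colour_link_rtrancl_same[OF path] by simp
  qed
  have A_link: "w \<in> A" if "v \<in> A" "w \<in> box" "\<forall>i. \<bar>v $ i - w $ i\<bar> \<le> 1" "\<kappa> v = \<kappa> w" for v w
  proof -
    have "v \<in> box" using that(1) unfolding A_def by blast
    then have "colour_link p \<kappa> v w" using that(2-4) unfolding colour_link_def box_def by blast
    then show ?thesis
      using that rtranclp.rtrancl_into_rtrancl[of "colour_link p \<kappa>"] unfolding A_def by blast
  qed
  define \<sigma> :: "int ^ 'n \<Rightarrow> real" where "\<sigma> v = (if v \<in> A then 1 else -1)" for v
  define D where "D x i = (\<Sum>v\<in>{v\<in>box. \<kappa> v = i}. \<sigma> v * tent v x)" for x i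
  define g where "g x = (\<chi> i. max 0 (min (real_of_int p) (x $ i + D x i)))" for x :: "real ^ 'n"
  define S where "S = cbox (0 :: real ^ 'n) (\<chi> i. real_of_int p)"
  have S: "x \<in> S \<longleftrightarrow> (\<forall>i. 0 \<le> x $ i \<and> x $ i \<le> real_of_int p)" for x
    unfolding S_def by (simp add: mem_box_cart)
  have "continuous_on S g"
    unfolding g_def D_def tent_def by (intro continuous_intros continuous_on_vec_lambda)
  moreover have "g \<in> S \<rightarrow> S" using p by (auto simp: S g_def)
  moreover have "S \<noteq> {}" using S[of 0] p by auto
  ultimately obtain x where x: "x \<in> S" "g x = x"
    using brouwer[of S g] compact_cbox convex_box(1) unfolding S_def by blast
  \<comment> \<open>Any lattice point with a positive tent at \<open>x\<close> gives a direction in which \<open>x\<close> has to move.\<close>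
  define v where "v = (\<chi> i. \<lfloor>x $ i\<rfloor>)"
  have "0 \<le> \<lfloor>x $ j\<rfloor> \<and> \<lfloor>x $ j\<rfloor> \<le> p" for j
    using x(1) floor_mono[of "x $ j" "real_of_int p"] unfolding S by simp
  then have v: "v \<in> box" unfolding box_def v_def by simp
  have "\<bar>x $ j - real_of_int \<lfloor>x $ j\<rfloor>\<bar> < 1" for j
    using floor_correct[of "x $ j"] by linarith
  then have v_pos: "0 < tent v x" unfolding tent_pos_iff v_def by simp
  define i where "i = \<kappa> v"
  have same: "w \<in> A \<longleftrightarrow> v \<in> A" if "w \<in> box" "\<kappa> w = i" "0 < tent w x" for w
  proof -
    have "\<bar>v $ j - w $ j\<bar> \<le> 1" for j
    proof -
      have "\<bar>x $ j - real_of_int (v $ j)\<bar> < 1" "\<bar>x $ j - real_of_int (w $ j)\<bar> < 1"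
        using v_pos that(3) unfolding tent_pos_iff by auto
      then have "real_of_int \<bar>v $ j - w $ j\<bar> < 2" by linarith
      then show ?thesis by linarith
    qed
    then show ?thesis
      using A_link[of v w] A_link[of w v] that v unfolding i_def by (auto simp: abs_minus_commute)
  qed
  have D: "D x i = \<sigma> v * (\<Sum>w\<in>{w\<in>box. \<kappa> w = i}. tent w x)"
    unfolding D_def sum_distrib_left
  proof (rule sum.cong)
    fix w assume w: "w \<in> {w\<in>box. \<kappa> w = i}"
    show "\<sigma> w * tent w x = \<sigma> v * tent w x"
      using same[of w] w tent_nonneg[of w x] unfolding \<sigma>_def by (cases "tent w x = 0") auto
  qed simp
  have pos: "0 < (\<Sum>w\<in>{w\<in>box. \<kappa> w = i}. tent w x)"
    by (rule sum_pos2[of _ v]) (use fin v v_pos tent_nonneg i_def in auto)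
  have fix_i: "x $ i = max 0 (min (real_of_int p) (x $ i + D x i))"
    using arg_cong[OF x(2), of "\<lambda>y. y $ i"] by (simp add: g_def)
  have xv: "\<bar>x $ i - real_of_int (v $ i)\<bar> < 1" using v_pos unfolding tent_pos_iff by blast
  have vi: "0 \<le> v $ i" "v $ i \<le> p" using v unfolding box_def by auto
  show False
  proof (cases "v \<in> A")
    case True
    then have "0 < D x i" using D pos by (simp add: \<sigma>_def)
    then have "x $ i = real_of_int p" using fix_i x(1) unfolding S by (smt (verit))
    then have "v $ i = p" using xv vi by linarith
    then show False using A_high[OF True] unfolding i_def by blast
  next
    case False
    then have "D x i < 0" using D pos by (simp add: \<sigma>_def)
    then have "x $ i = 0" using fix_i x(1) unfolding S by (smt (verit))
    then have "v $ i = 0" using xv vi by linarith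
    then show False using A_low[OF v] False unfolding i_def by blast
  qed
qed

lemma colour_component_meets_levels:
  assumes "(colour_link p \<kappa>)\<^sup>*\<^sup>* v w" "v $ i \<le> a" "a \<le> w $ i"
  shows "\<exists>u. (colour_link p \<kappa>)\<^sup>*\<^sup>* v u \<and> u $ i = a"
  using assms
proof (induction rule: rtranclp_induct)
  case (step w w')
  show ?case
  proof (cases "a \<le> w $ i")
    case False
    have "\<bar>w $ i - w' $ i\<bar> \<le> 1" using step.hyps(2) unfolding colour_link_def by blast
    then have "w' $ i = a" using False step.prems by linarith
    then show ?thesis using rtranclp.rtrancl_into_rtrancl[OF step.hyps] by blast
  qed (use step in blast)
qed auto

section \<open>Colouring the complement of well-spread holes\<close>

text \<open>
  The lattice \<open>\<int>\<^sup>n\<close> is cut into cubic cells of side \<open>L\<close>, each with a hole, a much smaller cube with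
  its centre in the middle third of the cell. Points outside the holes can be coloured with only
  \<open>n\<close> colours such that every component of a colour is bounded, where components are taken with
  respect to jumps of size at most \<open>R\<close>. The reason is that a punctured cube can be pushed onto its
  boundary, so that the points outside the holes go to the union of the walls, a set of dimension
  \<open>n - 1\<close>. A wall point is then coloured by the dimension of the lowest-dimensional face of the
  grid that it is close to. To stay within the integers, the image of the push is magnified by
  \<open>Q\<close>, so the walls in the image are at the multiples of \<open>Q * L\<close>.
\<close>

text \<open>
  The distance from \<open>a\<close> to the nearest multiple of \<open>N\<close>.
\<close>

definition grid_dist :: "int \<Rightarrow> int \<Rightarrow> int" where
  "grid_dist N a = min (a mod N) (N - a mod N)"

lemma grid_dist_bounds: "0 < N \<Longrightarrow> 0 \<le> grid_dist N a \<and> grid_dist N a \<le> N"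
  using pos_mod_bound[of N a] pos_mod_sign[of N a] unfolding grid_dist_def by linarith

lemma grid_dist_le:
  assumes "0 < N"
  shows "grid_dist N a \<le> \<bar>a - N * k\<bar>"
proof -
  have a: "a = N * (a div N) + a mod N" by simp
  have r: "0 \<le> a mod N" "a mod N < N" using assms by auto
  show ?thesis
  proof (cases "k \<le> a div N")
    case True
    then have "N * k \<le> N * (a div N)" using assms by simp
    then show ?thesis using a r unfolding grid_dist_def by linarith
  next
    case False
    then have "N * (a div N + 1) \<le> N * k" using assms by (intro mult_left_mono) auto
    then have "N * (a div N) + N \<le> N * k" by (simp add: distrib_left)
    then show ?thesis using a r unfolding grid_dist_def by linarith
  qed
qed

lemma grid_dist_attained: "\<exists>k. grid_dist N a = \<bar>a - N * k\<bar>" if "0 < N"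
proof (cases "a mod N \<le> N - a mod N")
  case True
  have "a - N * (a div N) = a mod N" by (simp add: minus_mult_div_eq_mod)
  then show ?thesis using True that by (intro exI[of _ "a div N"]) (simp add: grid_dist_def)
next
  case False
  have "N * (a div N + 1) - a = N - a mod N"
    using minus_mult_div_eq_mod[of a N] by (simp add: distrib_left)
  then show ?thesis using False pos_mod_bound[OF that, of a]
    by (intro exI[of _ "a div N + 1"]) (simp add: grid_dist_def abs_minus_commute)
qed

lemma grid_dist_Lipschitz:
  assumes "0 < N"
  shows "grid_dist N a \<le> grid_dist N b + \<bar>a - b\<bar>"
proof -
  obtain k where "grid_dist N b = \<bar>b - N * k\<bar>" using grid_dist_attained[OF assms] by blast
  then show ?thesis using grid_dist_le[OF assms, of a k] by linarith
qed

lemma grid_dist_le_if_div_differs: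
  assumes N: "0 < N" and ne: "a div N \<noteq> b div N"
  shows "grid_dist N a \<le> \<bar>a - b\<bar>"
proof -
  have *: "x \<le> N * (y div N)" if "x div N < y div N" for x y
  proof -
    have "N * (x div N + 1) \<le> N * (y div N)" using that N by (intro mult_left_mono) auto
    moreover have "x = N * (x div N) + x mod N" "x mod N < N" using N by auto
    ultimately show ?thesis unfolding distrib_left by linarith
  qed
  have floor: "N * (y div N) \<le> y" for y
    using minus_mult_div_eq_mod[of y N] pos_mod_sign[OF N, of y] by linarith
  show ?thesis
  proof (cases "a div N < b div N")
    case True
    then show ?thesis using *[OF True] floor[of b] grid_dist_le[OF N, of a "b div N"] by linarith
  next
    case False
    then have "b div N < a div N" using ne by simp
    then show ?thesis using *[of b a] floor[of a] grid_dist_le[OF N, of a "a div N"] by linarith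
  qed
qed

lemma grid_dist_half_shift:
  assumes "0 < H"
  shows "H \<le> grid_dist (2 * H) a + grid_dist (2 * H) (a + H)"
proof -
  have N: "0 < 2 * H" using assms by simp
  obtain k where k: "grid_dist (2 * H) a = \<bar>a - 2 * H * k\<bar>" using grid_dist_attained[OF N] by blast
  obtain l where l: "grid_dist (2 * H) (a + H) = \<bar>a + H - 2 * H * l\<bar>"
    using grid_dist_attained[OF N] by blast
  have "H * 1 \<le> H * \<bar>1 - 2 * (l - k)\<bar>"
    using assms by (intro mult_left_mono) presburger+
  also have "\<dots> = \<bar>H * (1 - 2 * (l - k))\<bar>" using assms by (simp add: abs_mult)
  also have "H * (1 - 2 * (l - k)) = (a + H - 2 * H * l) - (a - 2 * H * k)"
    by (simp add: algebra_simps)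
  finally show ?thesis using k l by linarith
qed

definition clamp_int :: "int \<Rightarrow> int \<Rightarrow> int \<Rightarrow> int" where
  "clamp_int lo hi a = max lo (min hi a)"

lemma clamp_int_Lipschitz: "\<bar>clamp_int lo hi a - clamp_int lo hi b\<bar> \<le> \<bar>a - b\<bar>"
  by (auto simp: clamp_int_def)

text \<open>
  The set \<open>Y\<close> consists of points outside the holes, and \<open>c\<close> gives the centre of the hole in
  each cell that meets \<open>Y\<close>; random holes are available in a bounded region only. Three orders
  of magnitude are involved: \<open>Q\<close> is a large multiple of the jump size \<open>R\<close>, so that pushing, which stretches distances by a factor of about
  \<open>2 * L\<close>, moves close points apart by a small fraction of \<open>Q * L\<close> only; the holes have radius
  \<open>12 * Q\<close>, enough for the push to reach a wall; and \<open>L\<close> may be arbitrarily large.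
\<close>

locale holes =
  fixes R L Q :: int and c :: "int ^ 'n::finite \<Rightarrow> int ^ 'n" and Y :: "(int ^ 'n) set"
  assumes R: "1 \<le> R"
    and Q: "Q = 8 * R * (int CARD('n) + 1)"
    and L: "4 * Q \<le> L" "even L"
    and centre: "\<And>y i. y \<in> Y \<Longrightarrow>
      L \<le> 3 * (c (\<chi> j. y $ j div L) $ i - L * (y $ i div L)) \<and>
      3 * (c (\<chi> j. y $ j div L) $ i - L * (y $ i div L)) \<le> 2 * L"
    and hole: "\<And>y. y \<in> Y \<Longrightarrow> \<exists>i. 12 * Q \<le> \<bar>y $ i - c (\<chi> j. y $ j div L) $ i\<bar>"
begin

abbreviation cell :: "int ^ 'n \<Rightarrow> int ^ 'n" where
  "cell y \<equiv> \<chi> j. y $ j div L"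

definition depth :: "int ^ 'n \<Rightarrow> int" where
  "depth y = Min ((\<lambda>j. grid_dist L (y $ j)) ` UNIV)"

text \<open>
  Points are moved away from the centre of their cell in proportion to their distance to the
  walls, and stop at the walls. Since the motion vanishes at the walls, the pushes in adjacent
  cells fit together even though their centres are unrelated.
\<close>

definition push :: "int ^ 'n \<Rightarrow> 'n \<Rightarrow> int" where
  "push y j = clamp_int (Q * L * (y $ j div L)) (Q * L * (y $ j div L) + Q * L)
     (Q * y $ j + depth y * (y $ j - c (cell y) $ j))"

text \<open>
  A bound on the distance between the pushed images of two points at distance at most \<open>R\<close>.
\<close>

abbreviation stretch :: int where
  "stretch \<equiv> Q * R + 2 * R * L"

lemma Q_pos: "1 \<le> Q"
proof -
  have "1 * 1 \<le> (8 * R) * (int CARD('n) + 1)" using R by (intro mult_mono) auto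
  then show ?thesis by (simp add: Q)
qed

lemma L_pos: "0 < L" using Q_pos L by linarith

lemma QL_pos: "0 < Q * L" using Q_pos L_pos by simp

lemma stretch_pos: "0 < stretch"
  using Q_pos L_pos R by (intro add_pos_pos mult_pos_pos) auto

lemma stretch_small: "2 * ((int CARD('n) + 1) * stretch) < Q * L"
proof -
  have "(2 * (int CARD('n) + 1) * R) * (Q + 2 * L) < (2 * (int CARD('n) + 1) * R) * (4 * L)"
    using L Q_pos R by (intro mult_strict_left_mono mult_pos_pos) auto
  also have "\<dots> = Q * L" unfolding Q by (simp add: algebra_simps)
  finally show ?thesis by (simp add: algebra_simps)
qed

lemma depth_le: "depth y \<le> grid_dist L (y $ j)"
  unfolding depth_def by (rule Min_le) auto

lemma depth_attained: "\<exists>j. depth y = grid_dist L (y $ j)"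
proof -
  have "depth y \<in> (\<lambda>j. grid_dist L (y $ j)) ` UNIV"
    unfolding depth_def by (rule Min_in) auto
  then show ?thesis by blast
qed

lemma depth_bounds: "0 \<le> depth y \<and> depth y \<le> L"
  using depth_attained[of y] grid_dist_bounds[OF L_pos] by metis

lemma depth_Lipschitz:
  assumes "\<And>j. \<bar>y $ j - y' $ j\<bar> \<le> R"
  shows "depth y \<le> depth y' + R"
proof -
  obtain j where "depth y' = grid_dist L (y' $ j)" using depth_attained by blast
  then show ?thesis
    using depth_le[of y j] grid_dist_Lipschitz[OF L_pos, of "y $ j" "y' $ j"] assms[of j] by linarith
qed

lemma div_bounds: "L * (a div L) \<le> a" "a < L * (a div L) + L"
  using minus_mult_div_eq_mod[of a L] pos_mod_sign[OF L_pos, of a] pos_mod_bound[OF L_pos, of a]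
  by linarith+

lemma dist_centre_le:
  assumes "y \<in> Y"
  shows "\<bar>y $ j - c (cell y) $ j\<bar> \<le> L"
  using centre[OF assms, of j] div_bounds[of "y $ j"] L_pos by (smt (verit))

lemma push_in_cell: "Q * L * (y $ j div L) \<le> push y j \<and> push y j \<le> Q * L * (y $ j div L) + Q * L"
  using QL_pos unfolding push_def clamp_int_def by auto

lemma scaled_in_cell: "Q * L * (a div L) \<le> Q * a \<and> Q * a \<le> Q * L * (a div L) + Q * L"
proof -
  have "Q * (L * (a div L)) \<le> Q * a" "Q * a \<le> Q * (L * (a div L) + L)"
    using div_bounds[of a] Q_pos by (intro mult_left_mono; linarith)+
  then show ?thesis by (simp add: algebra_simps)
qed

lemma push_displacement:
  assumes "y \<in> Y"
  shows "\<bar>push y j - Q * y $ j\<bar> \<le> depth y * L"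
proof -
  have "\<bar>push y j - Q * y $ j\<bar> \<le> \<bar>depth y * (y $ j - c (cell y) $ j)\<bar>"
    using scaled_in_cell[of "y $ j"] unfolding push_def clamp_int_def by linarith
  also have "\<dots> \<le> depth y * L"
    unfolding abs_mult using depth_bounds[of y] dist_centre_le[OF assms, of j]
    by (intro mult_mono) auto
  finally show ?thesis .
qed

text \<open>
  Within a cell this is the product rule. Two close points in different cells are both close to
  a wall, where the push is nearly the multiplication by \<open>Q\<close>.
\<close>

lemma push_Lipschitz:
  assumes y: "y \<in> Y" "y' \<in> Y" and near: "\<And>j. \<bar>y $ j - y' $ j\<bar> \<le> R"
  shows "\<bar>push y j - push y' j\<bar> \<le> stretch"
proof (cases "cell y = cell y'")
  case True
  then have eq: "y $ j div L = y' $ j div L" by (simp add: vec_eq_iff)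
  have dd: "\<bar>depth y - depth y'\<bar> \<le> R"
    using depth_Lipschitz[of y y'] depth_Lipschitz[of y' y] near
    by (auto simp: abs_minus_commute)
  let ?c = "c (cell y) $ j"
  have "\<bar>push y j - push y' j\<bar>
      \<le> \<bar>(Q * y $ j + depth y * (y $ j - ?c)) - (Q * y' $ j + depth y' * (y' $ j - ?c))\<bar>"
    unfolding push_def eq True[symmetric] by (rule clamp_int_Lipschitz)
  also have "\<dots> = \<bar>Q * (y $ j - y' $ j) + (depth y - depth y') * (y $ j - ?c)
      + depth y' * (y $ j - y' $ j)\<bar>"
    by (simp add: algebra_simps)
  also have "\<dots> \<le> \<bar>Q * (y $ j - y' $ j)\<bar> + \<bar>(depth y - depth y') * (y $ j - ?c)\<bar>
      + \<bar>depth y' * (y $ j - y' $ j)\<bar>" by linarith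
  also have "\<dots> \<le> Q * R + R * L + L * R"
    unfolding abs_mult using Q_pos near[of j] dd dist_centre_le[OF y(1), of j] depth_bounds[of y']
    by (intro add_mono mult_mono) auto
  finally show ?thesis by (simp add: algebra_simps)
next
  case False
  then obtain i where i: "y $ i div L \<noteq> y' $ i div L" by (auto simp: vec_eq_iff)
  have "depth y \<le> R"
    using depth_le[of y i] grid_dist_le_if_div_differs[OF L_pos i] near[of i] by linarith
  moreover have "depth y' \<le> R"
    using depth_le[of y' i] grid_dist_le_if_div_differs[OF L_pos i[symmetric]] near[of i] by linarith
  ultimately have "depth y * L \<le> R * L" "depth y' * L \<le> R * L" using L_pos by auto
  moreover have "\<bar>Q * y $ j - Q * y' $ j\<bar> \<le> Q * R"
    unfolding right_diff_distrib[symmetric] abs_mult using Q_pos near[of j] by (intro mult_mono) auto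
  ultimately show ?thesis
    using push_displacement[OF y(1), of j] push_displacement[OF y(2), of j] by linarith
qed

text \<open>
  Away from the walls the depth is at least \<open>L / 12\<close>, and a coordinate in which the point
  is outside the hole differs from that of the centre by at least \<open>12 * Q\<close>, so in this coordinate
  the point is moved by at least \<open>Q * L\<close>. Close to the walls, the coordinate attaining the depth differs from
  that of the centre by at least \<open>L / 4\<close>, because the centre is in the middle third, and the push in
  this coordinate covers the remaining distance \<open>Q * depth y\<close>.
\<close>

lemma push_hits_wall:
  assumes y: "y \<in> Y"
  shows "\<exists>j. grid_dist (Q * L) (push y j) = 0"
proof -
  have wall: "grid_dist (Q * L) (Q * L * k) = 0" "grid_dist (Q * L) (Q * L * k + Q * L) = 0" for k
    using QL_pos by (auto simp: grid_dist_def)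
  have hi: ?thesis if "Q * L * (y $ j div L) + Q * L \<le> Q * y $ j + depth y * (y $ j - c (cell y) $ j)" for j
  proof -
    have "push y j = Q * L * (y $ j div L) + Q * L"
      using that QL_pos unfolding push_def clamp_int_def by linarith
    then show ?thesis using wall by metis
  qed
  have lo: ?thesis if "Q * y $ j + depth y * (y $ j - c (cell y) $ j) \<le> Q * L * (y $ j div L)" for j
  proof -
    have "push y j = Q * L * (y $ j div L)"
      using that QL_pos unfolding push_def clamp_int_def by linarith
    then show ?thesis using wall by metis
  qed
  show ?thesis
  proof (cases "L \<le> 12 * depth y")
    case True
    obtain i where i: "12 * Q \<le> \<bar>y $ i - c (cell y) $ i\<bar>" using hole[OF y] by blast
    have "Q * L \<le> Q * (12 * depth y)" using True Q_pos by (intro mult_left_mono) auto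
    also have "\<dots> \<le> depth y * \<bar>y $ i - c (cell y) $ i\<bar>"
      using mult_left_mono[OF i, of "depth y"] depth_bounds[of y] by (simp add: algebra_simps)
    finally have big: "Q * L \<le> depth y * \<bar>y $ i - c (cell y) $ i\<bar>" .
    show ?thesis
    proof (cases "0 \<le> y $ i - c (cell y) $ i")
      case True
      then show ?thesis using hi[of i] big scaled_in_cell[of "y $ i"] by simp
    next
      case False
      then have "depth y * \<bar>y $ i - c (cell y) $ i\<bar> = - (depth y * (y $ i - c (cell y) $ i))"
        by (simp add: abs_if algebra_simps)
      then have "Q * y $ i + depth y * (y $ i - c (cell y) $ i) \<le> Q * L * (y $ i div L)"
        using big scaled_in_cell[of "y $ i"] by linarith
      then show ?thesis by (rule lo)
    qed
  next
    case False
    obtain j where j: "depth y = grid_dist L (y $ j)" using depth_attained by blast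
    have decomp: "y $ j = L * (y $ j div L) + y $ j mod L" by simp
    have cen: "L \<le> 3 * (c (cell y) $ j - L * (y $ j div L))"
      "3 * (c (cell y) $ j - L * (y $ j div L)) \<le> 2 * L" using centre[OF y, of j] by auto
    show ?thesis
    proof (cases "y $ j mod L \<le> L - y $ j mod L")
      case True
      then have m: "y $ j mod L = depth y" using j by (simp add: grid_dist_def)
      have "Q \<le> c (cell y) $ j - y $ j"
        using cen(1) decomp m False L(1) by (smt (verit))
      then have "depth y * Q \<le> depth y * (c (cell y) $ j - y $ j)"
        using depth_bounds[of y] by (intro mult_left_mono) auto
      moreover have "Q * y $ j = Q * L * (y $ j div L) + Q * depth y"
        by (subst decomp) (simp add: m algebra_simps)
      ultimately have "Q * y $ j + depth y * (y $ j - c (cell y) $ j) \<le> Q * L * (y $ j div L)"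
        by (simp add: algebra_simps)
      then show ?thesis by (rule lo)
    next
      case False': False
      then have m: "y $ j mod L = L - depth y" using j by (simp add: grid_dist_def)
      have "Q \<le> y $ j - c (cell y) $ j"
        using cen(2) decomp m False L(1) by (smt (verit))
      then have "depth y * Q \<le> depth y * (y $ j - c (cell y) $ j)"
        using depth_bounds[of y] by (intro mult_left_mono) auto
      moreover have "Q * y $ j = Q * L * (y $ j div L) + Q * L - Q * depth y"
        by (subst decomp) (simp add: m algebra_simps)
      ultimately have "Q * L * (y $ j div L) + Q * L \<le> Q * y $ j + depth y * (y $ j - c (cell y) $ j)"
        by (simp add: algebra_simps)
      then show ?thesis by (rule hi)
    qed
  qed
qed

text \<open>
  A pushed point with \<open>m\<close> coordinates close to multiples of \<open>Q * L\<close> is close to a face of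
  codimension \<open>m\<close>, and the colour is the largest such \<open>m\<close>. The tolerance grows with \<open>m\<close>, so that
  by maximality the remaining coordinates of a point of colour \<open>m\<close> miss not only its own
  tolerance but the next larger one. The label records the face itself.
\<close>

definition near_walls :: "int ^ 'n \<Rightarrow> nat \<Rightarrow> 'n set" where
  "near_walls y m = {j. grid_dist (Q * L) (push y j) \<le> int m * stretch}"

definition colour :: "int ^ 'n \<Rightarrow> nat" where
  "colour y = Max {m \<in> {1..CARD('n)}. m \<le> card (near_walls y m)}"

definition label :: "int ^ 'n \<Rightarrow> 'n set \<times> ('n \<Rightarrow> int)" where
  "label y = (near_walls y (colour y), \<lambda>j.
     (push y j + (if j \<in> near_walls y (colour y) then Q * (L div 2) else 0)) div (Q * L))"

lemma near_walls_mono: "m \<le> m' \<Longrightarrow> near_walls y m \<subseteq> near_walls y m'"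
proof
  fix j assume "m \<le> m'" "j \<in> near_walls y m"
  moreover have "int m * stretch \<le> int m' * stretch"
    using \<open>m \<le> m'\<close> stretch_pos by (intro mult_right_mono) auto
  ultimately show "j \<in> near_walls y m'" unfolding near_walls_def by auto
qed

lemma colour_range_and_count:
  assumes y: "y \<in> Y"
  shows "colour y \<in> {1..CARD('n)}" and "colour y \<le> card (near_walls y (colour y))"
proof -
  obtain j where "grid_dist (Q * L) (push y j) = 0" using push_hits_wall[OF y] by blast
  then have "j \<in> near_walls y 1" using stretch_pos by (simp add: near_walls_def)
  then have "1 \<le> card (near_walls y 1)"
    by (metis One_nat_def Suc_leI card_gt_0_iff empty_iff finite)
  then have "{m \<in> {1..CARD('n)}. m \<le> card (near_walls y m)} \<noteq> {}"
    by (intro ex_in_conv[THEN iffD1] exI[of _ 1]) (auto simp: Suc_le_eq)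
  then have "colour y \<in> {m \<in> {1..CARD('n)}. m \<le> card (near_walls y m)}"
    unfolding colour_def by (intro Max_in) auto
  then show "colour y \<in> {1..CARD('n)}" "colour y \<le> card (near_walls y (colour y))" by auto
qed

text \<open>
  The gap that separates different faces of the same colour.
\<close>

lemma near_walls_Suc_colour:
  assumes y: "y \<in> Y"
  shows "near_walls y (Suc (colour y)) = near_walls y (colour y)"
proof -
  note col = colour_range_and_count[OF y]
  have "card (near_walls y (Suc (colour y))) \<le> colour y"
  proof (cases "colour y = CARD('n)")
    case True
    then show ?thesis using card_mono[of UNIV "near_walls y (Suc (colour y))"] by simp
  next
    case False
    show ?thesis
    proof (rule ccontr)
      assume "\<not> card (near_walls y (Suc (colour y))) \<le> colour y"
      then have "Suc (colour y) \<in> {m \<in> {1..CARD('n)}. m \<le> card (near_walls y m)}"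
        using False col(1) by auto
      then have "Suc (colour y) \<le> colour y"
        unfolding colour_def by (intro Max_ge) auto
      then show False by simp
    qed
  qed
  moreover have sub: "near_walls y (colour y) \<subseteq> near_walls y (Suc (colour y))"
    by (rule near_walls_mono) simp
  ultimately have "card (near_walls y (Suc (colour y))) \<le> card (near_walls y (colour y))"
    using col(2) by simp
  then show ?thesis using card_seteq[OF _ sub] by simp
qed

lemma near_walls_subset:
  assumes y: "y \<in> Y" "y' \<in> Y" and near: "\<And>j. \<bar>y $ j - y' $ j\<bar> \<le> R"
  shows "near_walls y m \<subseteq> near_walls y' (Suc m)"
proof
  fix j assume "j \<in> near_walls y m"
  then show "j \<in> near_walls y' (Suc m)"
    using grid_dist_Lipschitz[OF QL_pos, of "push y' j" "push y j"] push_Lipschitz[OF y near, of j]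
    unfolding near_walls_def by (simp add: algebra_simps abs_minus_commute)
qed

text \<open>
  A jump changes each coordinate of the pushed point by at most one unit of tolerance. By the gap,
  the set of coordinates close to walls stays the same. Coordinates outside this set are too far from
  a wall to cross it, and those inside are too close to a wall to cross the middle between two walls,
  which is why the label shifts them by half a period.
\<close>

lemma label_eq_if_near:
  assumes y: "y \<in> Y" "y' \<in> Y" and near: "\<And>j. \<bar>y $ j - y' $ j\<bar> \<le> R" and col: "colour y = colour y'"
  shows "label y = label y'"
proof -
  have near': "\<bar>y' $ j - y $ j\<bar> \<le> R" for j using near[of j] by linarith
  let ?J = "near_walls y (colour y)"
  have "?J \<subseteq> near_walls y' (colour y')"
    using near_walls_subset[OF y near, of "colour y"] near_walls_Suc_colour[OF y(2)] col by simp
  moreover have "near_walls y' (colour y') \<subseteq> ?J"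
    using near_walls_subset[OF y(2,1) near', of "colour y"] near_walls_Suc_colour[OF y(1)] col
    by simp
  ultimately have J: "near_walls y' (colour y') = ?J" by blast
  have "(push y j + (if j \<in> ?J then Q * (L div 2) else 0)) div (Q * L)
      = (push y' j + (if j \<in> ?J then Q * (L div 2) else 0)) div (Q * L)" (is "?a div _ = ?b div _") for j
  proof (rule ccontr)
    assume ne: "?a div (Q * L) \<noteq> ?b div (Q * L)"
    have le: "grid_dist (Q * L) ?a \<le> stretch"
      using grid_dist_le_if_div_differs[OF QL_pos ne] push_Lipschitz[OF y near, of j] by linarith
    show False
    proof (cases "j \<in> ?J")
      case True
      have half: "2 * (Q * (L div 2)) = Q * L" using L(2) by simp
      have Hpos: "0 < Q * (L div 2)" using half QL_pos by linarith
      have "Q * (L div 2) \<le> grid_dist (Q * L) (push y j) + grid_dist (Q * L) (push y j + Q * (L div 2))"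
        using grid_dist_half_shift[OF Hpos, of "push y j"] unfolding half by simp
      moreover have "grid_dist (Q * L) (push y j) \<le> int (colour y) * stretch"
        using True unfolding near_walls_def by simp
      moreover have "int (colour y) * stretch \<le> int CARD('n) * stretch"
        using colour_range_and_count(1)[OF y(1)] stretch_pos by (intro mult_right_mono) auto
      moreover have "2 * (int CARD('n) * stretch + stretch) < 2 * (Q * (L div 2))"
        using stretch_small unfolding half by (simp add: algebra_simps)
      ultimately show False using le True by simp
    next
      case False
      then have "j \<notin> near_walls y (Suc (colour y))" using near_walls_Suc_colour[OF y(1)] by simp
      then have "int (Suc (colour y)) * stretch < grid_dist (Q * L) (push y j)"
        unfolding near_walls_def by simp
      moreover have "1 * stretch \<le> int (Suc (colour y)) * stretch"
        using stretch_pos by (intro mult_right_mono) auto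
      ultimately show False using le False by simp
    qed
  qed
  then show ?thesis unfolding label_def J by simp
qed

lemma dist_le_if_label_eq:
  assumes "label y = label y'"
  shows "\<bar>y $ j - y' $ j\<bar> \<le> 3 * L"
proof -
  have J: "near_walls y (colour y) = near_walls y' (colour y')" using assms unfolding label_def by simp
  define e where "e = (if j \<in> near_walls y (colour y) then Q * (L div 2) else 0)"
  have "(push y j + e) div (Q * L) = (push y' j + e) div (Q * L)"
    using fun_cong[OF arg_cong[OF assms, of snd], of j] unfolding label_def e_def J by simp
  then have "\<bar>(push y j + e) - (push y' j + e)\<bar> < Q * L"
    using minus_mult_div_eq_mod[of "push y j + e" "Q * L"] minus_mult_div_eq_mod[of "push y' j + e" "Q * L"]
      pos_mod_sign[OF QL_pos] pos_mod_bound[OF QL_pos]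
    by (smt (verit))
  then have "\<bar>Q * y $ j - Q * y' $ j\<bar> \<le> 3 * (Q * L)"
    using push_in_cell[of y j] scaled_in_cell[of "y $ j"] push_in_cell[of y' j] scaled_in_cell[of "y' $ j"]
    by linarith
  moreover have "Q * \<bar>y $ j - y' $ j\<bar> = \<bar>Q * y $ j - Q * y' $ j\<bar>"
    using Q_pos by (simp add: abs_mult flip: right_diff_distrib)
  ultimately have "Q * \<bar>y $ j - y' $ j\<bar> \<le> Q * (3 * L)" by simp
  then show ?thesis using Q_pos by simp
qed

end

section \<open>Monochromatic Lipschitz injections in equal dimension\<close>

lemma Lip_iterate:
  assumes M: "0 \<le> M" and f: "Lip M f"
  shows "l1_norm (f x - f y) \<le> M * l1_norm (x - y)"
proof (induction "nat (l1_norm (x - y))" arbitrary: y)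
  case 0
  then have "x = y" using l1_norm_nonneg[of "x - y"] l1_norm_eq_0_iff[of "x - y"] by simp
  then show ?case by simp
next
  case (Suc n)
  then have "x \<noteq> y" by auto
  then obtain i where i: "x $ i \<noteq> y $ i" by (auto simp: vec_eq_iff)
  define y' where "y' = y + axis i (sgn (x $ i - y $ i))"
  have "l1_norm (y' - y) = 1"
    using i by (simp add: y'_def l1_norm_axis)
  then have "l1_norm (f y' - f y) \<le> M" using f unfolding Lip_def by blast
  moreover have closer: "l1_norm (x - y') = l1_norm (x - y) - 1"
  proof -
    have "\<bar>x $ i - y $ i - sgn (x $ i - y $ i)\<bar> = \<bar>x $ i - y $ i\<bar> - 1"
      using i by (auto simp: sgn_if)
    then show ?thesis
      unfolding l1_norm_def sum.remove[OF finite UNIV_I[of i]]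
      by (simp add: y'_def axis_def)
  qed
  moreover have "l1_norm (f x - f y') \<le> M * l1_norm (x - y')"
    using Suc.hyps(1)[of y'] Suc.hyps(2) closer by simp
  moreover have "l1_norm (f x - f y) \<le> l1_norm (f x - f y') + l1_norm (f y' - f y)"
    using l1_norm_triangle[of "f x - f y'" "f y' - f y"] by simp
  ultimately show ?case by (simp add: right_diff_distrib)
qed

lemma l1_norm_le_card:
  fixes u :: "int ^ 'n::finite"
  assumes "\<And>i. \<bar>u $ i\<bar> \<le> r"
  shows "l1_norm u \<le> int CARD('n) * r"
  unfolding l1_norm_def using sum_bounded_above[of UNIV "\<lambda>i. \<bar>u $ i\<bar>" r] assms by simp

text \<open>
  Pulling the colouring back along \<open>g\<close>, the Hex lemma gives a monochromatic path across the box
  \<open>{0..p}\<^sup>n\<close>. Its image stays in one component of the colouring, hence in a cube of side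
  \<open>6 * L\<close>. But it has more than \<open>p\<close> points, which is too many for an injection into this cube.
\<close>

lemma (in holes) no_injection_avoiding_holes:
  fixes g :: "int ^ 'd::finite \<Rightarrow> int ^ 'n"
  assumes dim: "CARD('d) = CARD('n)" and inj: "inj g"
    and near: "\<And>x y j. (\<And>i. \<bar>x $ i - y $ i\<bar> \<le> 1) \<Longrightarrow> \<bar>g x $ j - g y $ j\<bar> \<le> R"
    and p: "p = (6 * L + 1) ^ CARD('n)"
    and Y: "\<And>x. (\<forall>i. x $ i \<in> {0..p}) \<Longrightarrow> g x \<in> Y"
  shows False
proof -
  have "0 \<le> p" using L_pos by (simp add: p)
  obtain e :: "nat \<Rightarrow> 'd" where e: "bij_betw e {1..CARD('n)} UNIV"
    using finite_same_card_bij[of "{1..CARD('n)}" "UNIV :: 'd set"] dim by auto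
  define \<kappa> where "\<kappa> x = e (colour (g x))" for x
  obtain v w where v: "\<forall>i. v $ i \<in> {0..p}" and vw: "(colour_link p \<kappa>)\<^sup>*\<^sup>* v w"
    and ends: "v $ \<kappa> v = 0" "w $ \<kappa> v = p"
    using hex[OF \<open>0 \<le> p\<close>, of \<kappa>] by blast
  define S where "S = {u. (colour_link p \<kappa>)\<^sup>*\<^sup>* v u}"
  have label: "label (g u) = label (g v)" if "u \<in> S" for u
  proof -
    have "(colour_link p \<kappa>)\<^sup>*\<^sup>* v u" using that by (simp add: S_def)
    then show ?thesis
    proof (induction rule: rtranclp_induct)
      case (step u u')
      then have in_Y: "g u \<in> Y" "g u' \<in> Y" and adj: "\<And>i. \<bar>u $ i - u' $ i\<bar> \<le> 1"
        and "e (colour (g u)) = e (colour (g u'))"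
        using Y unfolding colour_link_def \<kappa>_def by blast+
      then have "colour (g u) = colour (g u')"
        using bij_betw_imp_inj_on[OF e] colour_range_and_count(1) by (meson inj_onD)
      then show ?case using label_eq_if_near[OF in_Y near[OF adj]] step.IH by simp
    qed simp
  qed
  have "g ` S \<subseteq> int_cube (g v) (3 * L)"
    unfolding int_cube_def using label dist_le_if_label_eq by blast
  then have fin: "finite (g ` S)" and "card (g ` S) \<le> card (int_cube (g v) (3 * L))"
    using finite_int_cube finite_subset card_mono by blast+
  moreover have "card (g ` S) = card S" using inj by (intro card_image inj_on_subset[OF inj]) auto
  moreover have "card (int_cube (g v) (3 * L)) \<le> nat (2 * (3 * L) + 1) ^ CARD('n)"
    using L_pos by (intro card_int_cube_le) simp
  moreover have "int (nat (2 * (3 * L) + 1) ^ CARD('n)) = p"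
    using L_pos by (simp add: p)
  ultimately have le: "int (card S) \<le> p" by linarith
  have "finite S" using fin inj by (meson finite_imageD inj_on_subset subset_UNIV)
  moreover have "{0..p} \<subseteq> (\<lambda>u. u $ \<kappa> v) ` S"
    using colour_component_meets_levels[OF vw, of "\<kappa> v"] ends unfolding S_def by fastforce
  ultimately have "card {0..p} \<le> card S" using surj_card_le by blast
  then show False using le \<open>0 \<le> p\<close> by simp
qed

lemma polynomial_times_exponential_small:
  fixes \<theta> C e :: real
  assumes \<theta>: "0 \<le> \<theta>" "\<theta> < 1" and e: "0 < e" and m: "0 < m"
  shows "\<exists>T\<ge>1. C * real T ^ m * \<theta> ^ T \<le> e"
proof -
  define \<eta> where "\<eta> = root m \<theta>"
  have \<eta>: "\<eta> ^ m = \<theta>" "norm \<eta> < 1"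
    using \<theta> m by (auto simp: \<eta>_def)
  have "(\<lambda>T. C * (real T * \<eta> ^ T) ^ m) \<longlonglongrightarrow> C * 0 ^ m"
    by (intro tendsto_intros powser_times_n_limit_0 \<eta>)
  moreover have "C * 0 ^ m = 0" using m by (simp add: zero_power)
  ultimately have "(\<lambda>T. C * (real T * \<eta> ^ T) ^ m) \<longlonglongrightarrow> 0" by (simp only:)
  then have "eventually (\<lambda>T. C * (real T * \<eta> ^ T) ^ m < e) sequentially"
    using e by (rule order_tendstoD)
  then have "eventually (\<lambda>T. C * (real T * \<eta> ^ T) ^ m < e \<and> 1 \<le> T) sequentially"
    by (intro eventually_conj eventually_ge_at_top)
  then obtain T where T: "C * (real T * \<eta> ^ T) ^ m < e" "1 \<le> T"
    using eventually_happens'[OF sequentially_bot] by blast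
  have "(real T * \<eta> ^ T) ^ m = real T ^ m * \<theta> ^ T"
    by (simp add: power_mult_distrib flip: \<eta>(1) power_mult) (simp add: mult.commute)
  then show ?thesis using T by (intro exI[of _ T]) (simp add: mult.assoc)
qed

lemma int_cube_translate: "int_cube c r = (\<lambda>u. c + u) ` int_cube 0 r"
proof (intro set_eqI iffI)
  fix v assume "v \<in> int_cube c r"
  then have "v - c \<in> int_cube 0 r" by (simp add: int_cube_def)
  then show "v \<in> (\<lambda>u. c + u) ` int_cube 0 r" by (intro image_eqI[of _ _ "v - c"]) auto
qed (auto simp: int_cube_def)

lemma card_int_cube_translate:
  fixes c :: "int ^ 'n::finite"
  shows "card (int_cube c r) = card (int_cube (0 :: int ^ 'n) r)"
  unfolding int_cube_translate[of c] by (intro card_image inj_onI) auto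

lemma prob_no_monochromatic_cube:
  fixes cen :: "nat \<Rightarrow> int ^ 'D::finite"
  assumes p: "0 < p" "p < 1"
    and dis: "disjoint_family_on (\<lambda>t. int_cube (cen t) r) {..<T}"
  shows "{\<omega>. \<forall>t\<in>{..<T}. \<exists>y\<in>int_cube (cen t) r. \<omega> y = b} \<in> sets (percolation p)"
    and "measure (percolation p) {\<omega>. \<forall>t\<in>{..<T}. \<exists>y\<in>int_cube (cen t) r. \<omega> y = b}
      = (1 - (if b then 1 - p else p) ^ card (int_cube (0 :: int ^ 'D) r)) ^ T"
proof -
  interpret M: prob_space "percolation p :: 'D config measure" by (rule prob_space_percolation)
  let ?P = "\<lambda>t \<omega>. \<exists>y\<in>int_cube (cen t) r. \<omega> y = b"
  have det: "determined_by (int_cube (cen t) r) (?P t)" for t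
    unfolding determined_by_def by auto
  have "determined_by (\<Union>t\<in>{..<T}. int_cube (cen t) r) (\<lambda>\<omega>. \<forall>t\<in>{..<T}. ?P t \<omega>)"
    unfolding determined_by_def by (metis UN_I)
  then show "{\<omega>. \<forall>t\<in>{..<T}. ?P t \<omega>} \<in> sets (percolation p)"
    by (rule sets_determined_by[OF p, rotated]) (simp add: finite_int_cube)
  have one: "measure (percolation p) {\<omega>. ?P t \<omega>}
      = 1 - (if b then 1 - p else p) ^ card (int_cube (0 :: int ^ 'D) r)" for t
  proof -
    let ?A = "{\<omega>. \<forall>y\<in>int_cube (cen t) r. \<omega> y = (\<not> b)}"
    note cyl = cylinder_percolation[OF p finite_int_cube[of "cen t" r], of "\<lambda>_. \<not> b"]
    have "{\<omega>. ?P t \<omega>} = space (percolation p) - ?A" by auto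
    then have "measure (percolation p) {\<omega>. ?P t \<omega>} = 1 - measure (percolation p) ?A"
      by (simp only: M.prob_compl[OF cyl(1)])
    also have "measure (percolation p) ?A = (if b then 1 - p else p) ^ card (int_cube (0 :: int ^ 'D) r)"
      unfolding cyl(2) by (simp add: card_int_cube_translate[of "cen t"])
    finally show ?thesis .
  qed
  have "measure (percolation p) {\<omega>. \<forall>t\<in>{..<T}. ?P t \<omega>}
      = (\<Prod>t\<in>{..<T}. measure (percolation p) {\<omega>. ?P t \<omega>})"
    by (rule prob_disjoint_blocks[OF p finite_lessThan finite_int_cube dis det])
  then show "measure (percolation p) {\<omega>. \<forall>t\<in>{..<T}. ?P t \<omega>}
      = (1 - (if b then 1 - p else p) ^ card (int_cube (0 :: int ^ 'D) r)) ^ T"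
    by (simp add: one)
qed

text \<open>
  An injection \<open>g\<close> into the sites of state \<open>b\<close> avoids all cubes on which the state is
  constantly \<open>\<not> b\<close>. Cubes of a fixed size \<open>K\<close> already serve as holes. In a cell of side \<open>L\<close>
  proportional to \<open>T\<close> there are \<open>T\<close> disjoint candidates with centres in the middle third, so a cell has no hole
  with probability \<open>\<theta>\<^sup>T\<close>. The argument only concerns the cells within a distance of \<open>g 0\<close>
  that is polynomial in \<open>T\<close>, and therefore the probability that some \<open>g\<close> with a given value
  \<open>g 0\<close> exists is at most a polynomial in \<open>T\<close> times \<open>\<theta>\<^sup>T\<close>, for every \<open>T\<close>.
\<close>

lemma no_monochromatic_Lipschitz_injection:
  assumes dim: "CARD('d::finite) = CARD('D::finite)" and p: "0 < p" "p < 1" and M: "1 \<le> M"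
  shows "AE \<omega>::'D config in percolation p. \<not> (\<exists>g :: int ^ 'd \<Rightarrow> int ^ 'D. inj g \<and>
    (\<forall>x y. l1_norm (g x - g y) \<le> M * l1_norm (x - y)) \<and> (\<forall>x. \<omega> (g x) = b))"
proof -
  define n where "n = CARD('D)"
  have n: "0 < n" by (simp add: n_def)
  define R where "R = M * int n"
  define Q where "Q = 8 * R * (int n + 1)"
  define K where "K = 12 * Q"
  have "1 * 1 \<le> M * int n" using M n by (intro mult_mono) auto
  then have R: "1 \<le> R" by (simp add: R_def)
  have "1 * 1 \<le> (8 * R) * (int n + 1)" using R by (intro mult_mono) auto
  then have Q: "1 \<le> Q" by (simp add: Q_def)
  have K: "12 \<le> K" using Q by (simp add: K_def)
  obtain i0 :: 'D where True by blast
  define \<theta> where "\<theta> = 1 - (if b then 1 - p else p) ^ card (int_cube (0 :: int ^ 'D) (K - 1))"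
  have \<theta>: "0 \<le> \<theta>" "\<theta> < 1"
    using p unfolding \<theta>_def by (auto intro: power_le_one)
  define C where "C = ((3 * real_of_int M * real n) * (73 * real_of_int K) ^ n) ^ n"
  let ?inj = "\<lambda>\<omega> z. \<exists>g :: int ^ 'd \<Rightarrow> int ^ 'D. g 0 = z \<and> inj g \<and>
    (\<forall>x y. l1_norm (g x - g y) \<le> M * l1_norm (x - y)) \<and> (\<forall>x. \<omega> (g x) = b)"
  have "AE \<omega>::'D config in percolation p. \<not> ?inj \<omega> z" for z
  proof (rule AE_not_if_small_covers)
    fix e :: real assume "0 < e"
    then obtain T where T: "1 \<le> T" "C * real T ^ (n * n) * \<theta> ^ T \<le> e"
      using polynomial_times_exponential_small[OF \<theta>, of e "n * n" C] n by auto
    define L where "L = 12 * K * int T"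
    have L_eq: "L = 12 * (K * int T)" by (simp add: L_def)
    \<comment> \<open>\<open>s\<close> is the side of the box in the domain; its image lies within distance \<open>r\<close> of \<open>g 0\<close>.\<close>
    define s where "s = (6 * L + 1) ^ n"
    define r where "r = M * (int n * s)"
    have "K * 1 \<le> K * int T" using K T by (intro mult_left_mono) auto
    then have KT: "K \<le> K * int T" by simp
    have L: "0 < L" using KT K by (simp add: L_def)
    have s: "1 \<le> s" using L by (simp add: s_def)
    have "1 * 1 \<le> int n * s" using n s by (intro mult_mono) auto
    then have "1 * 1 \<le> M * (int n * s)" using M by (intro mult_mono) auto
    then have r: "1 \<le> r" by (simp add: r_def)
    \<comment> \<open>The candidates in the cell \<open>v\<close> are lined up in direction \<open>i0\<close>, starting from the middle \<open>L / 2\<close>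
      of the cell and ending before \<open>2 * L / 3\<close>.\<close>
    define cen :: "int ^ 'D \<Rightarrow> nat \<Rightarrow> int ^ 'D" where
      "cen v t = (\<chi> j. L * v $ j + 6 * (K * int T) + (if j = i0 then 2 * (K * int t) else 0))" for v t
    have dis: "disjoint_family_on (\<lambda>t. int_cube (cen v t) (K - 1)) {..<T}" for v
    proof (unfold disjoint_family_on_def, intro ballI impI)
      fix t t' :: nat assume "t \<noteq> t'"
      show "int_cube (cen v t) (K - 1) \<inter> int_cube (cen v t') (K - 1) = {}"
      proof (rule ccontr)
        assume "\<not> ?thesis"
        then obtain y where "\<bar>y $ i0 - cen v t $ i0\<bar> \<le> K - 1" "\<bar>y $ i0 - cen v t' $ i0\<bar> \<le> K - 1"
          unfolding int_cube_def by auto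
        then have "\<bar>2 * (K * int t) - 2 * (K * int t')\<bar> \<le> 2 * K - 2"
          unfolding cen_def by simp
        moreover have "2 * (K * int t) - 2 * (K * int t') = 2 * K * (int t - int t')"
          by (simp add: algebra_simps)
        moreover have "2 * K * 1 \<le> 2 * K * \<bar>int t - int t'\<bar>"
          using \<open>t \<noteq> t'\<close> K by (intro mult_left_mono) auto
        moreover have "\<bar>2 * K * (int t - int t')\<bar> = 2 * K * \<bar>int t - int t'\<bar>"
          using K by (simp add: abs_mult)
        ultimately show False by linarith
      qed
    qed
    define no_hole where "no_hole v \<omega> \<longleftrightarrow> (\<forall>t\<in>{..<T}. \<exists>y\<in>int_cube (cen v t) (K - 1). \<omega> y = b)"
      for v and \<omega> :: "'D config"
    note no_hole_prob = prob_no_monochromatic_cube[OF p dis, of _ b, folded no_hole_def \<theta>_def]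
    define V where "V = int_cube (\<chi> i. z $ i div L) r"
    have "real (card V) * \<theta> ^ T \<le> e"
    proof -
      have "card V \<le> nat (2 * r + 1) ^ n"
        unfolding V_def n_def using r by (intro card_int_cube_le) simp
      then have "real (card V) \<le> real (nat (2 * r + 1) ^ n)" by (rule of_nat_mono)
      also have "\<dots> = real_of_int (2 * r + 1) ^ n" using r by simp
      also have "\<dots> \<le> ((3 * real_of_int M * real n) * (73 * real_of_int K) ^ n * real T ^ n) ^ n"
      proof (rule power_mono)
        have "real_of_int (6 * L + 1) ^ n \<le> (73 * real_of_int K * real T) ^ n"
        proof (rule power_mono)
          have "6 * L + 1 \<le> 73 * (K * int T)" using KT K L_eq by linarith
          then have "real_of_int (6 * L + 1) \<le> real_of_int (73 * (K * int T))" by (rule of_int_le_iff[THEN iffD2])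
          then show "real_of_int (6 * L + 1) \<le> 73 * real_of_int K * real T" by simp
        qed (use L in simp)
        then have "(3 * real_of_int M * real n) * real_of_int s
            \<le> (3 * real_of_int M * real n) * (73 * real_of_int K * real T) ^ n"
          unfolding s_def using M by (intro mult_left_mono) auto
        moreover have "2 * r + 1 \<le> 3 * r" using r by simp
        then have "real_of_int (2 * r + 1) \<le> (3 * real_of_int M * real n) * real_of_int s"
          by (simp add: r_def flip: of_int_le_iff[where 'a=real])
        ultimately show "real_of_int (2 * r + 1)
            \<le> (3 * real_of_int M * real n) * (73 * real_of_int K) ^ n * real T ^ n"
          by (simp add: power_mult_distrib mult.assoc)
      qed (use r in simp)
      also have "\<dots> = C * real T ^ (n * n)"
        by (simp add: C_def power_mult_distrib power_mult)
      finally have "real (card V) * \<theta> ^ T \<le> C * real T ^ (n * n) * \<theta> ^ T"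
        using \<theta> by (intro mult_right_mono) auto
      then show ?thesis using T(2) by simp
    qed
    moreover have "measure (percolation p) (\<Union>v\<in>V. {\<omega>. no_hole v \<omega>}) \<le> real (card V) * \<theta> ^ T"
      using no_hole_prob by (intro prob_UN_le) (auto simp: V_def finite_int_cube)
    moreover have "(\<Union>v\<in>V. {\<omega>. no_hole v \<omega>}) \<in> sets (percolation p)"
      using no_hole_prob(1) by (intro sets.finite_UN) (auto simp: V_def finite_int_cube)
    moreover have "{\<omega>. ?inj \<omega> z} \<subseteq> (\<Union>v\<in>V. {\<omega>. no_hole v \<omega>})"
    proof
      fix \<omega> assume "\<omega> \<in> {\<omega>. ?inj \<omega> z}"
      then obtain g :: "int ^ 'd \<Rightarrow> int ^ 'D" where g0: "g 0 = z" and g: "inj g"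
        "\<And>x y. l1_norm (g x - g y) \<le> M * l1_norm (x - y)" "\<And>x. \<omega> (g x) = b" by blast
      show "\<omega> \<in> (\<Union>v\<in>V. {\<omega>. no_hole v \<omega>})"
      proof (rule ccontr)
        assume "\<omega> \<notin> (\<Union>v\<in>V. {\<omega>. no_hole v \<omega>})"
        then have "\<exists>t<T. \<forall>y\<in>int_cube (cen v t) (K - 1). \<omega> y \<noteq> b" if "v \<in> V" for v
          using that unfolding no_hole_def by auto
        then obtain t where t: "\<And>v. v \<in> V \<Longrightarrow> t v < T"
          "\<And>v y. v \<in> V \<Longrightarrow> y \<in> int_cube (cen v (t v)) (K - 1) \<Longrightarrow> \<omega> y \<noteq> b" by metis
        define c where "c v = cen v (t v)" for v
        define Y where "Y = g ` {x. \<forall>i. x $ i \<in> {0..s}}"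
        have cell_in_V: "(\<chi> j. y $ j div L) \<in> V" if "y \<in> Y" for y
        proof -
          obtain x where x: "y = g x" "\<forall>i. x $ i \<in> {0..s}" using \<open>y \<in> Y\<close> unfolding Y_def by blast
          have "l1_norm (x - 0) \<le> int CARD('d) * s"
            by (rule l1_norm_le_card) (use x(2) in \<open>simp add: abs_le_iff\<close>)
          then have "M * l1_norm (x - 0) \<le> r"
            unfolding r_def n_def dim using M by (intro mult_left_mono) auto
          then have "l1_norm (y - z) \<le> r" using g(2)[of x 0] g0 x(1) by simp
          then have "\<bar>y $ i - z $ i\<bar> \<le> r" for i
            using component_le_l1_norm[of "y - z" i] by simp
          moreover have "\<bar>a div L - a' div L\<bar> \<le> \<bar>a - a'\<bar>" for a a'
          proof -
            have *: "a div L - a' div L \<le> a - a'" if "a' \<le> a" for a a' :: int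
            proof -
              have "1 * (a - a') \<le> L * (a - a')" using L that by (intro mult_right_mono) auto
              then have "a div L \<le> (a' + L * (a - a')) div L"
                using L by (intro zdiv_mono1) auto
              then show ?thesis using L by simp
            qed
            show ?thesis
              using *[of a a'] *[of a' a] zdiv_mono1[of a a' L] zdiv_mono1[of a' a L] L
              by (cases "a \<le> a'") auto
          qed
          ultimately show ?thesis unfolding V_def int_cube_def by (auto intro: order_trans)
        qed
        interpret holes R L Q c Y
        proof
          show "1 \<le> R" by (rule R)
          show "Q = 8 * R * (int CARD('D) + 1)" by (simp add: Q_def n_def)
          show "4 * Q \<le> L" using KT Q by (simp add: L_def K_def)
          show "even L" by (simp add: L_def)
          fix y assume y: "y \<in> Y"
          let ?v = "\<chi> j. y $ j div L"
          show "L \<le> 3 * (c ?v $ i - L * (y $ i div L)) \<and> 3 * (c ?v $ i - L * (y $ i div L)) \<le> 2 * L" for i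
          proof -
            have "0 \<le> K * int (t ?v)" using K by simp
            moreover have "K * int (t ?v) \<le> K * int T"
              using t(1)[OF cell_in_V[OF y]] K by (intro mult_left_mono) auto
            moreover have "c ?v $ i - L * (y $ i div L)
                = 6 * (K * int T) + (if i = i0 then 2 * (K * int (t ?v)) else 0)"
              by (simp add: c_def cen_def)
            ultimately show ?thesis using L_eq by (auto split: if_splits)
          qed
          have "\<omega> y = b" using y g(3) unfolding Y_def by blast
          then have "y \<notin> int_cube (c ?v) (K - 1)"
            using t(2)[OF cell_in_V[OF y]] unfolding c_def by blast
          then obtain i where "\<not> \<bar>y $ i - c ?v $ i\<bar> \<le> K - 1"
            unfolding int_cube_def by blast
          then have "12 * Q \<le> \<bar>y $ i - c ?v $ i\<bar>" unfolding K_def by linarith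
          then show "\<exists>i. 12 * Q \<le> \<bar>y $ i - c ?v $ i\<bar>" by (rule exI)
        qed
        show False
        proof (rule no_injection_avoiding_holes[OF dim g(1)])
          show "s = (6 * L + 1) ^ CARD('D)" by (simp add: s_def n_def)
          show "\<And>x. \<forall>i. x $ i \<in> {0..s} \<Longrightarrow> g x \<in> Y" unfolding Y_def by blast
          fix x y :: "int ^ 'd" and j assume "\<And>i. \<bar>x $ i - y $ i\<bar> \<le> 1"
          then have "l1_norm (x - y) \<le> int n"
            using l1_norm_le_card[of "x - y" 1] by (simp add: n_def dim)
          then have "M * l1_norm (x - y) \<le> R"
            unfolding R_def using M by (intro mult_left_mono) auto
          then show "\<bar>g x $ j - g y $ j\<bar> \<le> R"
            using g(2)[of x y] component_le_l1_norm[of "g x - g y" j] by simp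
        qed
      qed
    qed
    ultimately show "\<exists>N\<in>sets (percolation p). {\<omega>. ?inj \<omega> z} \<subseteq> N \<and> measure (percolation p) N \<le> e"
      by (intro bexI[of _ "\<Union>v\<in>V. {\<omega>. no_hole v \<omega>}"]) auto
  qed
  then have "AE \<omega>::'D config in percolation p. \<forall>z. \<not> ?inj \<omega> z"
    by (subst AE_all_countable) auto
  then show ?thesis by eventually_elim auto
qed

text \<open>
  Restricted to the sublattice of its period, a partially periodic configuration is constant, and an
  embedding restricts to a monochromatic injection with the Lipschitz constant \<open>M * r\<close>.
\<close>

lemma no_Lip_embedding_of_partially_periodic:
  fixes \<eta> :: "'d::finite config"
  assumes dim: "CARD('d) = CARD('D::finite)" and \<eta>: "partially_periodic \<eta>"
    and p: "0 < p" "p < 1" and M: "1 \<le> M"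
  shows "AE \<omega>::'D config in percolation p. \<not> (\<exists>f. Lip_embedding M \<eta> \<omega> f)"
proof -
  obtain x r where r: "0 < r" and per: "\<And>y. \<eta> (x + r *s y) = \<eta> x"
    using \<eta> unfolding partially_periodic_def by metis
  have "1 * 1 \<le> M * r" using M r by (intro mult_mono) auto
  then have "AE \<omega>::'D config in percolation p. \<not> (\<exists>g :: int ^ 'd \<Rightarrow> int ^ 'D. inj g \<and>
      (\<forall>y y'. l1_norm (g y - g y') \<le> (M * r) * l1_norm (y - y')) \<and> (\<forall>y. \<omega> (g y) = \<eta> x))"
    by (intro no_monochromatic_Lipschitz_injection dim p) simp
  then show ?thesis
  proof eventually_elim
    case (elim \<omega>)
    show ?case
    proof
      assume "\<exists>f. Lip_embedding M \<eta> \<omega> f"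
      then obtain f where f: "inj f" "\<And>y. \<eta> y = \<omega> (f y)" "Lip M f"
        unfolding Lip_embedding_def embedding_def by auto
      define g where "g y = f (x + r *s y)" for y
      have "inj g"
        unfolding g_def
      proof (rule injI)
        fix y y' assume "f (x + r *s y) = f (x + r *s y')"
        then have "r *s y = r *s y'" using f(1) by (auto dest: injD)
        then show "y = y'" using r by (simp add: vec_eq_iff)
      qed
      moreover have "l1_norm (g y - g y') \<le> (M * r) * l1_norm (y - y')" for y y'
      proof -
        have "l1_norm ((x + r *s y) - (x + r *s y')) = r * l1_norm (y - y')"
          unfolding l1_norm_def sum_distrib_left
          by (intro sum.cong) (use r in \<open>auto simp: abs_mult simp flip: right_diff_distrib\<close>)
        then show ?thesis
          using Lip_iterate[OF _ f(3), of "x + r *s y" "x + r *s y'"] M by (simp add: g_def mult.assoc)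
      qed
      moreover have "\<omega> (g y) = \<eta> x" for y
        using f(2)[of "x + r *s y"] per[of y] by (simp add: g_def)
      ultimately show False using elim by blast
    qed
  qed
qed

section \<open>Embeddings of configurations\<close>

theorem proposition4:
  shows "(CARD('d::finite) \<ge> 2 \<longrightarrow>
           (\<forall>p::real. \<forall>\<eta>::'d config. 0 < p \<and> p < 1 \<longrightarrow>
             (AE \<omega>::'D::finite config in percolation p. \<not> (\<exists>f. Lip_embedding 1 \<eta> \<omega> f))))
       \<and> (CARD('d) < CARD('D) \<longrightarrow>
           (\<forall>p::real. 0 < p \<and> p < 1 \<longrightarrow>
             (\<exists>M::int. M \<ge> 1 \<and>
               (AE \<omega>::'D config in percolation p.
                 \<forall>\<eta>::'d config. \<exists>f. Lip_embedding M \<eta> \<omega> f))))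
       \<and> (CARD('d) = CARD('D) \<longrightarrow>
           (\<forall>\<eta>::'d config. partially_periodic \<eta> \<longrightarrow>
             (\<forall>p::real. 0 < p \<and> p < 1 \<longrightarrow>
               (\<forall>M::int. M \<ge> 1 \<longrightarrow>
                 (AE \<omega>::'D config in percolation p. \<not> (\<exists>f. Lip_embedding M \<eta> \<omega> f))))))"
proof (intro conjI impI allI)
  fix p :: real and \<eta> :: "'d config"
  assume "CARD('d) \<ge> 2" "0 < p \<and> p < 1"
  then show "AE \<omega>::'D config in percolation p. \<not> (\<exists>f. Lip_embedding 1 \<eta> \<omega> f)"
    using no_1_Lip_embedding by blast
next
  fix p :: real
  assume "CARD('d) < CARD('D)" "0 < p \<and> p < 1"
  then show "\<exists>M::int. M \<ge> 1 \<and>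
      (AE \<omega>::'D config in percolation p. \<forall>\<eta>::'d config. \<exists>f. Lip_embedding M \<eta> \<omega> f)"
    using Lip_embedding_in_higher_dimension by blast
next
  fix \<eta> :: "'d config" and p :: real and M :: int
  assume "CARD('d) = CARD('D)" "partially_periodic \<eta>" "0 < p \<and> p < 1" "M \<ge> 1"
  then show "AE \<omega>::'D config in percolation p. \<not> (\<exists>f. Lip_embedding M \<eta> \<omega> f)"
    using no_Lip_embedding_of_partially_periodic by blast
qed

end
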